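(* There is a randomized polynomial-time algorithm with $\mathsf{NP}$ oracle access that, given a polynomial-size circuit representation of a function $f:\{0,1\}^n\to\{0,1\}$ and a string $x^\star\in\{0,1\}^n$, outputs, with probability at least $1-n^{-\omega(1)}$, a certificate $S\subseteq[n]$ for $f$'s value on $x^\star$ satisfying $|S|=O(\mathrm{Cert}(f)^5)$. (The algorithm is not given the value of $\mathrm{Cert}(f)$.)
   Context: For $f:\{0,1\}^n\to\{0,1\}$ and $x^\star\in\{0,1\}^n$, a certificate for $f$'s value at $x^\star$ is a set $S\subseteq[n]$ such that $f(y)=f(x^\star)$ for every $y\in\{0,1\}^n$ with $y_S=x^\star_S$ (i.e. $y_i=x^\star_i$ for all $i\in S$). $\mathrm{Cert}(f,x^\star)$ denotes the minimum size of a certificate for $f$'s value at $x^\star$, and $\mathrm{Cert}(f)=\max_{x\in\{0,1\}^n}\mathrm{Cert}(f,x)$ is the certificate complexity of $f$. *)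

theory Defs
  imports "HOL-Probability.Probability" "HOL-Computational_Algebra.Polynomial"
begin

section \<open>Certificate complexity\<close>

text \<open>A function $\{0,1\}^n \to \{0,1\}$ is represented by \<open>f :: bool list \<Rightarrow> bool\<close>, of which only
  the values on lists of length \<open>n\<close> matter; coordinates are numbered \<open>0, \<dots>, n - 1\<close>.\<close>

definition certificate :: "nat \<Rightarrow> (bool list \<Rightarrow> bool) \<Rightarrow> bool list \<Rightarrow> nat set \<Rightarrow> bool" where
  "certificate n f x S \<longleftrightarrow> S \<subseteq> {..<n} \<and>
     (\<forall>y. length y = n \<longrightarrow> (\<forall>i\<in>S. y ! i = x ! i) \<longrightarrow> f y = f x)"

definition Cert_at :: "nat \<Rightarrow> (bool list \<Rightarrow> bool) \<Rightarrow> bool list \<Rightarrow> nat" where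
  "Cert_at n f x = Min (card ` {S. certificate n f x S})"

definition Cert :: "nat \<Rightarrow> (bool list \<Rightarrow> bool) \<Rightarrow> nat" where
  "Cert n f = Max (Cert_at n f ` {x. length x = n})"


section \<open>Boolean circuits\<close>

text \<open>A circuit is a list of gates in topological order. The arguments of \<open>GNot\<close>, \<open>GAnd\<close> and
  \<open>GOr\<close> are positions of earlier gates in the list, the argument of \<open>GInput\<close> is the number of an
  input bit; the last gate is the output.\<close>

datatype gate = GConst bool | GInput nat | GNot nat | GAnd nat nat | GOr nat nat

type_synonym circuit = "gate list"

fun wf_gate :: "nat \<Rightarrow> nat \<Rightarrow> gate \<Rightarrow> bool" where
  "wf_gate n k (GConst b) \<longleftrightarrow> True"
| "wf_gate n k (GInput i) \<longleftrightarrow> i < n"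
| "wf_gate n k (GNot i) \<longleftrightarrow> i < k"
| "wf_gate n k (GAnd i j) \<longleftrightarrow> i < k \<and> j < k"
| "wf_gate n k (GOr i j) \<longleftrightarrow> i < k \<and> j < k"

definition wf_circuit :: "nat \<Rightarrow> circuit \<Rightarrow> bool" where
  "wf_circuit n C \<longleftrightarrow> C \<noteq> [] \<and> (\<forall>k<length C. wf_gate n k (C ! k))"

fun gate_value :: "bool list \<Rightarrow> bool list \<Rightarrow> gate \<Rightarrow> bool" where
  "gate_value x vs (GConst b) = b"
| "gate_value x vs (GInput i) = x ! i"
| "gate_value x vs (GNot i) = (\<not> vs ! i)"
| "gate_value x vs (GAnd i j) = (vs ! i \<and> vs ! j)"
| "gate_value x vs (GOr i j) = (vs ! i \<or> vs ! j)"

definition circuit_fun :: "circuit \<Rightarrow> bool list \<Rightarrow> bool" where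
  "circuit_fun C x = last (foldl (\<lambda>vs g. vs @ [gate_value x vs g]) [] C)"

text \<open>Numbers are encoded in unary. As all of them are below the number of gates or the number
  of inputs, the encoding of a circuit together with its input is polynomially related in length
  to the number of gates plus the number of inputs.\<close>

definition encode_nat :: "nat \<Rightarrow> bool list" where
  "encode_nat k = replicate k True @ [False]"

fun encode_gate :: "gate \<Rightarrow> bool list" where
  "encode_gate (GConst b) = [False, False, b]"
| "encode_gate (GInput i) = [False, True] @ encode_nat i"
| "encode_gate (GNot i) = [True, False] @ encode_nat i"
| "encode_gate (GAnd i j) = [True, True, False] @ encode_nat i @ encode_nat j"
| "encode_gate (GOr i j) = [True, True, True] @ encode_nat i @ encode_nat j"

definition encode_circuit :: "circuit \<Rightarrow> bool list" where
  "encode_circuit C = concat (map (\<lambda>g. True # encode_gate g) C) @ [False]"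

text \<open>The encoding of a circuit is self-delimiting, so \<open>C\<close> and \<open>x\<close> (hence also \<open>n = length x\<close>) can
  be recovered from the encoding of an instance.\<close>

definition encode_instance :: "circuit \<Rightarrow> bool list \<Rightarrow> bool list" where
  "encode_instance C x = encode_circuit C @ x"

definition encode_set :: "nat \<Rightarrow> nat set \<Rightarrow> bool list" where
  "encode_set n S = map (\<lambda>i. i \<in> S) [0..<n]"


section \<open>Probabilistic oracle machines\<close>

text \<open>Machines are structured programs over finitely many stacks of bits, the stacks playing the
  role of the (half-)tapes of a multitape Turing machine. Every step other than an oracle query
  inspects or changes only the top of one stack, so a program corresponds to a multitape
  (probabilistic, oracle) Turing machine with the same running time up to a constant factor:
  the continuations occurring in a run of a fixed program range over a finite set (the control
  states), and a tape is a pair of stacks.\<close>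

type_synonym reg = nat

datatype prog =
    Skip
  | Push reg bool
  | Pop reg
  | Flip reg
  | Query reg reg
  | Seq prog prog
  | Case reg prog prog prog
  | While reg prog

type_synonym store = "reg \<Rightarrow> bool list"

text \<open>The list of programs in a configuration is the remaining computation; the machine has
  halted when it is empty.\<close>

type_synonym config = "prog list \<times> store"

text \<open>One time step with oracle \<open>A\<close>. A fresh random bit \<open>b\<close> is supplied in every step and is
  ignored except by \<open>Flip\<close>. \<open>Query q r\<close> pushes on \<open>r\<close> the oracle's answer for the content of \<open>q\<close>;
  \<open>Case r c d e\<close> branches on whether \<open>r\<close> is empty, has top \<open>True\<close> or has top \<open>False\<close>;
  \<open>While r\<close> loops as long as \<open>r\<close> is nonempty.\<close>

fun step :: "bool list set \<Rightarrow> bool \<Rightarrow> config \<Rightarrow> config" where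
  "step A b ([], \<sigma>) = ([], \<sigma>)"
| "step A b (Skip # K, \<sigma>) = (K, \<sigma>)"
| "step A b (Push r a # K, \<sigma>) = (K, \<sigma>(r := a # \<sigma> r))"
| "step A b (Pop r # K, \<sigma>) = (K, \<sigma>(r := tl (\<sigma> r)))"
| "step A b (Flip r # K, \<sigma>) = (K, \<sigma>(r := b # \<sigma> r))"
| "step A b (Query q r # K, \<sigma>) = (K, \<sigma>(r := (\<sigma> q \<in> A) # \<sigma> r))"
| "step A b (Seq c d # K, \<sigma>) = (c # d # K, \<sigma>)"
| "step A b (Case r c d e # K, \<sigma>) =
     ((case \<sigma> r of [] \<Rightarrow> c | a # _ \<Rightarrow> if a then d else e) # K, \<sigma>)"
| "step A b (While r c # K, \<sigma>) = (if \<sigma> r = [] then K else c # While r c # K, \<sigma>)"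

text \<open>The \<open>i\<close>-th input string is initially on stack \<open>i\<close>, all other stacks are empty; the output is
  the content of stack 0 upon halting. The length of \<open>bs\<close> is the number of steps performed.\<close>

definition init :: "prog \<Rightarrow> bool list list \<Rightarrow> config" where
  "init M xs = ([M], \<lambda>i. if i < length xs then xs ! i else [])"

definition run :: "bool list set \<Rightarrow> prog \<Rightarrow> bool list list \<Rightarrow> bool list \<Rightarrow> config" where
  "run A M xs bs = fold (step A) bs (init M xs)"

definition halted :: "config \<Rightarrow> bool" where
  "halted c \<longleftrightarrow> fst c = []"

definition result :: "config \<Rightarrow> bool list" where
  "result c = snd c 0"

definition runs_in_time :: "bool list set \<Rightarrow> prog \<Rightarrow> nat \<Rightarrow> (nat \<Rightarrow> nat) \<Rightarrow> bool" where
  "runs_in_time A M k T \<longleftrightarrow>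
     (\<forall>xs bs. length xs = k \<longrightarrow> length bs = T (sum_list (map length xs)) \<longrightarrow>
        halted (run A M xs bs))"

definition result_dist :: "bool list set \<Rightarrow> prog \<Rightarrow> bool list list \<Rightarrow> nat \<Rightarrow> bool list pmf" where
  "result_dist A M xs t =
     map_pmf (\<lambda>bs. result (run A M xs bs)) (pmf_of_set {bs. length bs = t})"


section \<open>The class NP\<close>

primrec deterministic :: "prog \<Rightarrow> bool" where
  "deterministic Skip = True"
| "deterministic (Push r a) = True"
| "deterministic (Pop r) = True"
| "deterministic (Flip r) = False"
| "deterministic (Query q r) = True"
| "deterministic (Seq c d) = (deterministic c \<and> deterministic d)"
| "deterministic (Case r c d e) = (deterministic c \<and> deterministic d \<and> deterministic e)"
| "deterministic (While r c) = deterministic c"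

primrec oracle_free :: "prog \<Rightarrow> bool" where
  "oracle_free Skip = True"
| "oracle_free (Push r a) = True"
| "oracle_free (Pop r) = True"
| "oracle_free (Flip r) = True"
| "oracle_free (Query q r) = False"
| "oracle_free (Seq c d) = (oracle_free c \<and> oracle_free d)"
| "oracle_free (Case r c d e) = (oracle_free c \<and> oracle_free d \<and> oracle_free e)"
| "oracle_free (While r c) = oracle_free c"

text \<open>Since the verifier \<open>V\<close> is deterministic and oracle-free, its oracle (here \<open>{}\<close>) and the bits
  supplied to it (here all \<open>False\<close>) are irrelevant.\<close>

definition NP :: "bool list set set" where
  "NP = {L. \<exists>V (p :: nat poly) (q :: nat poly).
     deterministic V \<and> oracle_free V \<and> runs_in_time {} V 2 (poly p) \<and>
     (\<forall>x. x \<in> L \<longleftrightarrow>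
        (\<exists>w. length w \<le> poly q (length x) \<and>
           result (run {} V [x, w] (replicate (poly p (length x + length w)) False)) = [True]))}"

end

theory Submission
  imports Defs
begin

text \<open>The algorithm is deterministic. If \<open>B\<close> is an inclusion-minimal sensitive block of \<open>x\<close>, then flipping
  \<open>B\<close> yields a point at which every coordinate of \<open>B\<close> is sensitive, so \<open>|B| \<le> Cert f\<close>. Disjoint
  sensitive blocks of \<open>x\<close> are all met by any certificate of \<open>x\<close>, so there are at most \<open>Cert f\<close> of them.
  Hence the union of a maximal disjoint family of minimal sensitive blocks has at most
  \<open>(Cert f)^2\<close> elements, and it is a certificate by maximality (Nisan). Whether a set of coordinates
  contains a sensitive block is an NP question, so an NP oracle finds a minimal block inside the set of
  coordinates not yet used by dropping coordinates greedily.\<close>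

section \<open>Sensitive blocks and certificates\<close>

text \<open>The bound obtained is quadratic and the success probability is 1, so the exponent 5 and
  the error term leave room. What shapes the proof is the machine model. Running time is demanded on
  every input string and an NP language consists of arbitrary strings, so the parsers are total
  functions with default values on malformed code, and the programs are shown to compute these
  functions; well-formed encodings matter only for correctness. One circuit evaluator serves both
  the NP verifier and the machine, and the machine also uses it to find where the circuit code stops
  and the input point begins. A query carries a mask, the value at \<open>x\<close> and the point
  \<open>x\<close> in front of the instance, so that a single fixed oracle answers all queries,
  evaluating the circuit once for each. The machine performs exactly \<open>n\<close> rounds instead
  of testing whether a block is left: blocks are nonempty, so \<open>n\<close> rounds exhaust them,
  and a surplus round changes nothing.\<close>

text \<open>In the usual terminology: \<open>F\<close> contains a sensitive block of \<open>x\<close>.\<close>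

definition sensitive :: "nat \<Rightarrow> (bool list \<Rightarrow> bool) \<Rightarrow> bool list \<Rightarrow> nat set \<Rightarrow> bool" where
  "sensitive n f x F \<longleftrightarrow>
     (\<exists>y. length y = n \<and> (\<forall>i<n. i \<notin> F \<longrightarrow> y ! i = x ! i) \<and> f y \<noteq> f x)"

definition minimal_sensitive :: "nat \<Rightarrow> (bool list \<Rightarrow> bool) \<Rightarrow> bool list \<Rightarrow> nat set \<Rightarrow> bool" where
  "minimal_sensitive n f x F \<longleftrightarrow>
     F \<subseteq> {..<n} \<and> sensitive n f x F \<and> (\<forall>i\<in>F. \<not> sensitive n f x (F - {i}))"

lemma sensitive_mono: "sensitive n f x F \<Longrightarrow> F \<subseteq> G \<Longrightarrow> sensitive n f x G"
  unfolding sensitive_def by blast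

lemma not_sensitive_empty: "length x = n \<Longrightarrow> \<not> sensitive n f x {}"
  unfolding sensitive_def using nth_equalityI[of _ x] by fastforce

lemma certificate_iff_not_sensitive:
  "S \<subseteq> {..<n} \<Longrightarrow> certificate n f x S \<longleftrightarrow> \<not> sensitive n f x ({..<n} - S)"
  unfolding certificate_def sensitive_def by (auto simp: subset_iff)

lemma certificate_meets_sensitive:
  assumes "certificate n f x S" "sensitive n f x F"
  shows "S \<inter> F \<noteq> {}"
  using assms unfolding certificate_def sensitive_def by (metis disjoint_iff lessThan_iff subsetD)

lemma certificate_UNIV: "length x = n \<Longrightarrow> certificate n f x {..<n}"
  unfolding certificate_def by (auto intro!: arg_cong[of _ _ f] nth_equalityI)

lemma finite_certificate_sets: "finite {S. certificate n f x S}"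
  by (rule finite_subset[of _ "Pow {..<n}"]) (auto simp: certificate_def)

lemma Cert_at_attained:
  assumes "length x = n"
  obtains S where "certificate n f x S" "card S = Cert_at n f x"
proof -
  have "Cert_at n f x \<in> card ` {S. certificate n f x S}"
    unfolding Cert_at_def using certificate_UNIV[OF assms]
    by (intro Min_in finite_imageI finite_certificate_sets) auto
  then show ?thesis using that by auto
qed

lemma Cert_at_le_Cert:
  assumes "length x = n"
  shows "Cert_at n f x \<le> Cert n f"
  unfolding Cert_def using assms finite_lists_length_eq[of "UNIV :: bool set" n]
  by (intro Max_ge finite_imageI) auto

text \<open>At the point obtained from \<open>x\<close> by flipping a minimal sensitive block, every coordinate of the
  block is sensitive.\<close>

lemma card_minimal_sensitive:
  assumes x: "length x = n" and F: "minimal_sensitive n f x F"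
  shows "card F \<le> Cert n f"
proof -
  have Fn: "F \<subseteq> {..<n}" and min: "\<And>i. i \<in> F \<Longrightarrow> \<not> sensitive n f x (F - {i})"
    using F by (auto simp: minimal_sensitive_def)
  obtain y where y: "length y = n" "\<forall>i<n. i \<notin> F \<longrightarrow> y ! i = x ! i" "f y \<noteq> f x"
    using F by (auto simp: minimal_sensitive_def sensitive_def)
  obtain S where S: "certificate n f y S" "card S = Cert_at n f y"
    by (rule Cert_at_attained[OF y(1)])
  have "F \<subseteq> S"
  proof
    fix i assume i: "i \<in> F"
    \<comment> \<open>Undoing the change at \<open>i\<close> confines the difference from
      \<open>x\<close> to \<open>F - {i}\<close>, which is not sensitive. So \<open>?z\<close> has
      the value of \<open>x\<close>, although it can differ from \<open>y\<close> only at
      \<open>i\<close>.\<close>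
    let ?z = "y[i := x ! i]"
    have z: "length ?z = n" "\<forall>j<n. j \<notin> F - {i} \<longrightarrow> ?z ! j = x ! j"
      using y i Fn by (auto simp: nth_list_update subset_iff)
    then have "f ?z = f x"
      using min[OF i] unfolding sensitive_def by blast
    then have "f ?z \<noteq> f y" using y(3) by simp
    then obtain j where "j \<in> S" "?z ! j \<noteq> y ! j"
      using S(1) z(1) unfolding certificate_def by blast
    then show "i \<in> S" by (metis nth_list_update_neq)
  qed
  moreover have "finite S"
    using S(1) by (auto simp: certificate_def intro: finite_subset)
  ultimately have "card F \<le> Cert_at n f y"
    using S(2) card_mono by metis
  also have "\<dots> \<le> Cert n f" by (rule Cert_at_le_Cert[OF y(1)])
  finally show ?thesis .
qed

text \<open>Picking in each block a point of one smallest certificate of \<open>x\<close> is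
  injective by disjointness.\<close>

lemma card_disjoint_sensitive:
  assumes x: "length x = n" and disj: "disjoint \<F>" and sens: "\<And>F. F \<in> \<F> \<Longrightarrow> sensitive n f x F"
    and fin: "finite \<F>"
  shows "card \<F> \<le> Cert n f"
proof -
  obtain S where S: "certificate n f x S" "card S = Cert_at n f x"
    by (rule Cert_at_attained[OF x])
  have finS: "finite S"
    using S(1) by (auto simp: certificate_def intro: finite_subset)
  have "\<forall>F\<in>\<F>. \<exists>i. i \<in> S \<inter> F"
    using certificate_meets_sensitive[OF S(1) sens] by blast
  then obtain h where h: "\<And>F. F \<in> \<F> \<Longrightarrow> h F \<in> S \<inter> F" by metis
  have "inj_on h \<F>"
    using h disj unfolding inj_on_def disjoint_def by (metis IntD2 disjoint_iff)
  then have "card \<F> \<le> card S"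
    using h finS by (intro card_inj_on_le[of h]) auto
  also have "\<dots> \<le> Cert n f"
    using S(2) Cert_at_le_Cert[OF x] by simp
  finally show ?thesis .
qed

lemma card_Union_disjoint_minimal_sensitive:
  assumes "length x = n" "finite \<F>" "disjoint \<F>" "\<And>F. F \<in> \<F> \<Longrightarrow> minimal_sensitive n f x F"
  shows "card (\<Union>\<F>) \<le> Cert n f ^ 2"
proof -
  have "card (\<Union>\<F>) \<le> (\<Sum>F\<in>\<F>. card F)"
    by (rule card_Union_le_sum_card)
  also have "\<dots> \<le> (\<Sum>F\<in>\<F>. Cert n f)"
    using assms card_minimal_sensitive by (intro sum_mono) blast
  also have "\<dots> = card \<F> * Cert n f" by simp
  also have "\<dots> \<le> Cert n f * Cert n f"
    using assms card_disjoint_sensitive[of x n \<F> f]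
    by (intro mult_right_mono) (auto simp: minimal_sensitive_def)
  finally show ?thesis by (simp add: power2_eq_square)
qed

section \<open>Greedy removal of minimal sensitive blocks\<close>

abbreviation mask_set :: "bool list \<Rightarrow> nat set" where
  "mask_set m \<equiv> {i. i < length m \<and> m ! i}"

text \<open>The first argument decides whether a mask contains a sensitive block; the second holds the part
  of the mask that is already final, in reverse.\<close>

fun shrink :: "(bool list \<Rightarrow> bool) \<Rightarrow> bool list \<Rightarrow> bool list \<Rightarrow> bool list" where
  "shrink Q l [] = l"
| "shrink Q l (b # m) = shrink Q ((b \<and> \<not> Q (rev (False # l) @ m)) # l) m"

definition shrunk :: "(bool list \<Rightarrow> bool) \<Rightarrow> bool list \<Rightarrow> bool list" where
  "shrunk Q u = rev (shrink Q [] u)"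

definition remove_block :: "(bool list \<Rightarrow> bool) \<Rightarrow> bool list \<Rightarrow> bool list" where
  "remove_block Q u = (if Q u then map2 (\<lambda>a b. a \<and> \<not> b) u (shrunk Q u) else u)"

lemma length_shrink: "length (shrink Q l m) = length l + length m"
  by (induction Q l m rule: shrink.induct) auto

lemma length_shrunk: "length (shrunk Q u) = length u"
  by (simp add: shrunk_def length_shrink)

lemma length_remove_block: "length (remove_block Q u) = length u"
  by (simp add: remove_block_def length_shrunk)

text \<open>One pass suffices because sensitivity is monotone: a coordinate that cannot be dropped
  from the current mask cannot be dropped from any later, smaller mask. The last assumption carries
  this for the part that is already final.\<close>

lemma shrink_minimal:
  assumes Q: "\<And>m. length m = n \<Longrightarrow> Q m \<longleftrightarrow> sensitive n f x (mask_set m)"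
    and "length l + length m = n" "Q (rev l @ m)"
    and "\<And>i. i < length l \<Longrightarrow> rev l ! i \<Longrightarrow> \<not> sensitive n f x (mask_set (rev l @ m) - {i})"
  shows "minimal_sensitive n f x (mask_set (rev (shrink Q l m)))
    \<and> mask_set (rev (shrink Q l m)) \<subseteq> mask_set (rev l @ m)"
  using assms(2-)
proof (induction m arbitrary: l)
  case Nil
  then show ?case
    using Q[of "rev l"] unfolding minimal_sensitive_def by (auto simp: subset_iff)
next
  case (Cons b m)
  let ?l = "(b \<and> \<not> Q (rev (False # l) @ m)) # l"
  let ?old = "rev l @ b # m" and ?new = "rev ?l @ m"
  have sub: "mask_set ?new \<subseteq> mask_set ?old"
    by (auto simp: nth_append nth_Cons')
  have "minimal_sensitive n f x (mask_set (rev (shrink Q ?l m)))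
    \<and> mask_set (rev (shrink Q ?l m)) \<subseteq> mask_set ?new"
  proof (rule Cons.IH)
    show "length ?l + length m = n" using Cons.prems by simp
    \<comment> \<open>Either the mask is unchanged, or it is the mask for which \<open>Q\<close> has
      just answered yes.\<close>
    show "Q ?new"
      using Cons.prems(2) by (cases b; cases "Q (rev (False # l) @ m)") auto
    fix i assume i: "i < length ?l" "rev ?l ! i"
    show "\<not> sensitive n f x (mask_set ?new - {i})"
    proof (cases "i < length l")
      case True
      then have "\<not> sensitive n f x (mask_set ?old - {i})"
        using i Cons.prems(3)[of i] by (simp add: nth_append)
      then show ?thesis using sub sensitive_mono[of n f x] by blast
    next
      case False
      then have il: "i = length l" and "b" and nQ: "\<not> Q (rev (False # l) @ m)"
        using i by (auto simp: nth_append)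
      have "mask_set ?new - {i} \<subseteq> mask_set (rev (False # l) @ m)"
        using il by (auto simp: nth_append nth_Cons')
      then show ?thesis
        using nQ Q[of "rev (False # l) @ m"] Cons.prems(1) sensitive_mono[of n f x] by auto
    qed
  qed
  then show ?case using sub by auto
qed

text \<open>Invariant of the rounds. The family is existentially quantified because the program
  keeps only the mask; the blocks themselves serve for counting.\<close>

definition covered :: "nat \<Rightarrow> (bool list \<Rightarrow> bool) \<Rightarrow> bool list \<Rightarrow> bool list \<Rightarrow> bool" where
  "covered n f x u \<longleftrightarrow> length u = n \<and>
     (\<exists>\<F>. finite \<F> \<and> disjoint \<F> \<and> (\<forall>F\<in>\<F>. minimal_sensitive n f x F) \<and>
        {..<n} - mask_set u = \<Union>\<F>)"

text \<open>The new block is found inside the current mask and is therefore disjoint from the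
  earlier ones. It is nonempty because the empty set is never sensitive.\<close>

lemma remove_block_covered:
  assumes Q: "\<And>m. length m = n \<Longrightarrow> Q m \<longleftrightarrow> sensitive n f x (mask_set m)"
    and x: "length x = n" and u: "covered n f x u"
  shows "covered n f x (remove_block Q u)"
    and "Q u \<Longrightarrow> card (mask_set (remove_block Q u)) < card (mask_set u)"
proof -
  let ?F = "mask_set (shrunk Q u)"
  have len: "length u = n" using u by (simp add: covered_def)
  have F: "minimal_sensitive n f x ?F" "?F \<subseteq> mask_set u" if "Q u"
    using shrink_minimal[OF Q, of "[]" u] that len by (auto simp: shrunk_def)
  have mask: "mask_set (remove_block Q u) = mask_set u - ?F" if "Q u"
    using that by (auto simp: remove_block_def length_shrunk)
  show "covered n f x (remove_block Q u)"
  proof (cases "Q u")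
    case True
    obtain \<F> where \<F>: "finite \<F>" "disjoint \<F>" "\<forall>F\<in>\<F>. minimal_sensitive n f x F"
      "{..<n} - mask_set u = \<Union>\<F>"
      using u by (auto simp: covered_def)
    have "?F \<inter> \<Union>\<F> = {}"
      using F(2)[OF True] unfolding \<F>(4)[symmetric] by blast
    then have "disjoint (insert ?F \<F>)"
      using \<F>(2) unfolding disjoint_def by (simp add: Int_commute disjoint_iff) blast
    moreover have "{..<n} - mask_set (remove_block Q u) = \<Union>(insert ?F \<F>)"
      unfolding mask[OF True] using \<F>(4) F(2)[OF True] len by auto
    ultimately show ?thesis
      unfolding covered_def using \<F>(1,3) F(1)[OF True] len
      by (intro conjI exI[of _ "insert ?F \<F>"]) (auto simp: length_remove_block)
  qed (use u in \<open>simp add: remove_block_def\<close>)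
  show "card (mask_set (remove_block Q u)) < card (mask_set u)" if "Q u"
  proof -
    have "?F \<noteq> {}"
      using F(1)[OF that] not_sensitive_empty[OF x] unfolding minimal_sensitive_def by metis
    then show ?thesis
      unfolding mask[OF that] using F(2)[OF that] by (intro psubset_card_mono) auto
  qed
qed

text \<open>Potential argument: if a sensitive block is still left after \<open>k\<close> rounds,
  each of these rounds has removed at least one coordinate.\<close>

lemma remove_blocks_covered:
  assumes Q: "\<And>m. length m = n \<Longrightarrow> Q m \<longleftrightarrow> sensitive n f x (mask_set m)"
    and x: "length x = n" and u: "covered n f x u"
  shows "covered n f x ((remove_block Q ^^ k) u) \<and>
    (Q ((remove_block Q ^^ k) u) \<longrightarrow> card (mask_set ((remove_block Q ^^ k) u)) + k \<le> card (mask_set u))"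
proof (induction k)
  case 0
  then show ?case using u by simp
next
  case (Suc k)
  let ?v = "(remove_block Q ^^ k) u"
  \<comment> \<open>A mask without a sensitive block is a fixed point of the round, so a positive
    answer now implies one in the round before.\<close>
  have "Q (remove_block Q ?v) \<Longrightarrow> Q ?v" by (simp add: remove_block_def split: if_splits)
  then show ?case
    using Suc remove_block_covered[OF Q x, of ?v] by fastforce
qed

definition greedy_mask :: "(bool list \<Rightarrow> bool) \<Rightarrow> nat \<Rightarrow> bool list" where
  "greedy_mask Q n = (remove_block Q ^^ n) (replicate n True)"

lemma length_greedy_mask: "length (greedy_mask Q n) = n"
proof -
  have "length ((remove_block Q ^^ k) u) = length u" for k u
    by (induction k) (auto simp: length_remove_block)
  then show ?thesis by (simp add: greedy_mask_def)
qed

lemma greedy_mask_certificate: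
  assumes x: "length x = n"
    and Q: "\<And>m. length m = n \<Longrightarrow> Q m \<longleftrightarrow> sensitive n f x (mask_set m)"
  defines "S \<equiv> {..<n} - mask_set (greedy_mask Q n)"
  shows "certificate n f x S" and "card S \<le> Cert n f ^ 2"
proof -
  let ?u = "greedy_mask Q n"
  have "covered n f x (replicate n True)"
    unfolding covered_def by (intro conjI exI[of _ "{}"]) auto
  from remove_blocks_covered[OF Q x this, of n]
  have cov: "covered n f x ?u" and card: "Q ?u \<Longrightarrow> card (mask_set ?u) + n \<le> card (mask_set (replicate n True))"
    unfolding greedy_mask_def by auto
  have len: "length ?u = n" by (rule length_greedy_mask)
  \<comment> \<open>The potential would leave only the empty mask after \<open>n\<close> rounds, and
    that is not sensitive.\<close>
  have "\<not> Q ?u"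
  proof
    assume "Q ?u"
    have "mask_set (replicate n True) = {..<n}" by auto
    then have "card (mask_set ?u) = 0"
      using card[OF \<open>Q ?u\<close>] by simp
    then have "mask_set ?u = {}" by simp
    with \<open>Q ?u\<close> Q[OF len] have "sensitive n f x {}" by (simp only:)
    then show False using not_sensitive_empty[OF x] by blast
  qed
  moreover have "{..<n} - S = mask_set ?u" using len by (auto simp: S_def)
  ultimately show "certificate n f x S"
    using Q[OF len] by (subst certificate_iff_not_sensitive) (auto simp: S_def)
  show "card S \<le> Cert n f ^ 2"
    using cov card_Union_disjoint_minimal_sensitive[OF x] unfolding covered_def S_def by metis
qed

section \<open>Timed execution of programs\<close>

text \<open>The number \<open>t\<close> of steps is fixed before the continuation \<open>K\<close>
  and the random bits, so runs can be chained by cutting the bit list at known places.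
  \<open>T\<close> merely caps \<open>t\<close>, which allows bounds to be rounded up.\<close>

definition executes :: "bool list set \<Rightarrow> prog \<Rightarrow> store \<Rightarrow> store \<Rightarrow> nat \<Rightarrow> bool" where
  "executes A c \<sigma> \<sigma>' T \<longleftrightarrow>
     (\<exists>t\<le>T. \<forall>K bs. length bs = t \<longrightarrow> fold (step A) bs (c # K, \<sigma>) = (K, \<sigma>'))"

text \<open>Applied first in most proofs below: the rules then compute some final store and time,
  and these are compared with the claimed ones afterwards.\<close>

lemma executes_weaken:
  assumes "executes A c \<sigma> \<sigma>1 T1" "\<sigma>1 = \<sigma>2" "T1 \<le> T2"
  shows "executes A c \<sigma> \<sigma>2 T2"
  using assms unfolding executes_def by (meson order_trans)

lemma executes_Skip: "executes A Skip \<sigma> \<sigma> 1"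
  and executes_Push: "executes A (Push r a) \<sigma> (\<sigma>(r := a # \<sigma> r)) 1"
  and executes_Pop: "executes A (Pop r) \<sigma> (\<sigma>(r := tl (\<sigma> r))) 1"
  and executes_Query: "executes A (Query q r) \<sigma> (\<sigma>(r := (\<sigma> q \<in> A) # \<sigma> r)) 1"
  and executes_While_Nil: "\<sigma> r = [] \<Longrightarrow> executes A (While r c) \<sigma> \<sigma> 1"
  by (auto simp: executes_def length_Suc_conv intro!: exI[of _ 1])

lemma executes_first_step:
  assumes step: "\<And>b K. step A b (c # K, \<sigma>) = (d # K, \<sigma>)"
    and "executes A d \<sigma> \<sigma>' T"
  shows "executes A c \<sigma> \<sigma>' (Suc T)"
proof -
  obtain t where t: "t \<le> T"
    "\<And>K bs. length bs = t \<Longrightarrow> fold (step A) bs (d # K, \<sigma>) = (K, \<sigma>')"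
    using assms(2) unfolding executes_def by blast
  have "fold (step A) bs (c # K, \<sigma>) = (K, \<sigma>')" if "length bs = Suc t" for bs K
    using that t(2) by (auto simp: length_Suc_conv step)
  then show ?thesis
    unfolding executes_def using t(1) by (intro exI[of _ "Suc t"]) auto
qed

text \<open>Common core of sequencing and looping; after the first step the remaining bits are split
  between \<open>d\<close> and \<open>e\<close>.\<close>

lemma executes_first_step2:
  assumes step: "\<And>b K. step A b (c # K, \<sigma>) = (d # e # K, \<sigma>)"
    and "executes A d \<sigma> \<sigma>1 T1" and "executes A e \<sigma>1 \<sigma>2 T2"
  shows "executes A c \<sigma> \<sigma>2 (Suc (T1 + T2))"
proof -
  obtain t where t: "t \<le> T1"
    "\<And>K bs. length bs = t \<Longrightarrow> fold (step A) bs (d # K, \<sigma>) = (K, \<sigma>1)"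
    using assms(2) unfolding executes_def by blast
  obtain u where u: "u \<le> T2"
    "\<And>K bs. length bs = u \<Longrightarrow> fold (step A) bs (e # K, \<sigma>1) = (K, \<sigma>2)"
    using assms(3) unfolding executes_def by blast
  have "fold (step A) bs (c # K, \<sigma>) = (K, \<sigma>2)" if len: "length bs = Suc (t + u)" for bs K
  proof -
    obtain b cs where bs: "bs = b # cs" "length cs = t + u"
      using len by (cases bs) auto
    have "fold (step A) bs (c # K, \<sigma>)
      = fold (step A) (drop t cs) (fold (step A) (take t cs) (d # e # K, \<sigma>))"
      by (simp add: bs step flip: fold_append comp_apply[of "fold _ (drop t cs)"])
    then show ?thesis
      using bs t(2)[of "take t cs"] u(2)[of "drop t cs"] by simp
  qed
  then show ?thesis
    unfolding executes_def using t(1) u(1) by (intro exI[of _ "Suc (t + u)"]) auto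
qed

lemma executes_Seq:
  assumes "executes A c \<sigma> \<sigma>1 T1" and "executes A d \<sigma>1 \<sigma>2 T2"
  shows "executes A (Seq c d) \<sigma> \<sigma>2 (Suc (T1 + T2))"
  by (rule executes_first_step2[OF _ assms]) simp

lemma executes_While_step:
  assumes "\<sigma> r \<noteq> []" and "executes A c \<sigma> \<sigma>1 T1" and "executes A (While r c) \<sigma>1 \<sigma>2 T2"
  shows "executes A (While r c) \<sigma> \<sigma>2 (Suc (T1 + T2))"
  by (rule executes_first_step2[OF _ assms(2,3)]) (simp add: assms)

lemma executes_Case_Nil:
  "\<sigma> r = [] \<Longrightarrow> executes A c \<sigma> \<sigma>' T \<Longrightarrow> executes A (Case r c d e) \<sigma> \<sigma>' (Suc T)"
  and executes_Case_True:
  "\<sigma> r = True # l \<Longrightarrow> executes A d \<sigma> \<sigma>' T \<Longrightarrow> executes A (Case r c d e) \<sigma> \<sigma>' (Suc T)"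
  and executes_Case_False:
  "\<sigma> r = False # l \<Longrightarrow> executes A e \<sigma> \<sigma>' T \<Longrightarrow> executes A (Case r c d e) \<sigma> \<sigma>' (Suc T)"
  by (rule executes_first_step; simp)+

abbreviation seq :: "prog \<Rightarrow> prog \<Rightarrow> prog" (infixr ";;" 60) where
  "c ;; d \<equiv> Seq c d"

text \<open>Surplus steps are harmless since a halted configuration is a fixed point of
  \<open>step\<close>.\<close>

lemma executes_run:
  assumes "executes A M (\<lambda>i. if i < length xs then xs ! i else []) \<sigma>' T" and "T \<le> length bs"
  shows "run A M xs bs = ([], \<sigma>')"
proof -
  obtain t where t: "t \<le> T"
    "\<And>K bs. length bs = t \<Longrightarrow> fold (step A) bs (init M xs) = ([], \<sigma>')"
    using assms(1) unfolding executes_def init_def by blast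
  have halt: "fold (step A) cs ([], \<sigma>') = ([], \<sigma>')" for cs
    by (induction cs) auto
  have "run A M xs bs = fold (step A) (drop t bs) (fold (step A) (take t bs) (init M xs))"
    unfolding run_def by (simp flip: fold_append comp_apply[of "fold _ (drop t bs)"])
  then show ?thesis
    using t assms(2) halt by simp
qed

section \<open>Branching on a popped bit, and loops that consume a stack\<close>

definition branch :: "reg \<Rightarrow> (bool \<Rightarrow> prog) \<Rightarrow> prog" where
  "branch r c = Case r Skip (Pop r ;; c True) (Pop r ;; c False)"

text \<open>The body depends on the popped bit through a function of the logic, so the bit is
  remembered in the finite control and not on a stack.\<close>

definition For :: "reg \<Rightarrow> (bool \<Rightarrow> prog) \<Rightarrow> prog" where
  "For r c = While r (branch r c)"

text \<open>The stack \<open>g\<close>, which is empty before and after a \<open>ForTrue\<close> loop, holds the loop condition.\<close>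

definition true_loop :: "reg \<Rightarrow> reg \<Rightarrow> prog \<Rightarrow> prog" where
  "true_loop g r c = While g (Case r (Pop g) (Pop r ;; c) (Pop r ;; Pop g))"

definition ForTrue :: "reg \<Rightarrow> reg \<Rightarrow> prog \<Rightarrow> prog" where
  "ForTrue g r c = Push g True ;; true_loop g r c"

lemma executes_branch_Nil: "\<sigma> r = [] \<Longrightarrow> executes A (branch r c) \<sigma> \<sigma> 2"
  unfolding branch_def
  by (rule executes_weaken, rule executes_Case_Nil, assumption, rule executes_Skip) auto

lemma executes_branch_Cons:
  assumes "\<sigma> r = b # l" and "executes A (c b) (\<sigma>(r := l)) \<sigma>' T"
  shows "executes A (branch r c) \<sigma> \<sigma>' (T + 3)"
proof -
  have *: "executes A (Pop r ;; c b) \<sigma> \<sigma>' (T + 2)"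
    by (rule executes_weaken, rule executes_Seq[OF executes_Pop], simp add: assms(1),
        rule assms(2)) auto
  show ?thesis
    unfolding branch_def
    by (cases b; rule executes_weaken,
      (rule executes_Case_True executes_Case_False, use assms(1) in simp, use * in simp)) auto
qed

lemma executes_For_Nil: "\<sigma> r = [] \<Longrightarrow> executes A (For r c) \<sigma> \<sigma> 1"
  unfolding For_def by (rule executes_While_Nil)

lemma executes_For_Cons:
  assumes "\<sigma> r = b # l" and "executes A (c b) (\<sigma>(r := l)) \<sigma>1 T1"
    and "executes A (For r c) \<sigma>1 \<sigma>2 T2"
  shows "executes A (For r c) \<sigma> \<sigma>2 (T1 + T2 + 4)"
  unfolding For_def
  by (rule executes_weaken, rule executes_While_step,
      use assms in simp, rule executes_branch_Cons, rule assms, rule assms,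
      rule assms(3)[unfolded For_def]) auto

lemma executes_true_loop_Nil:
  assumes "\<sigma> r = []" "\<sigma> g = [True]"
  shows "executes A (true_loop g r c) \<sigma> (\<sigma>(g := [])) 4"
  unfolding true_loop_def
  by (rule executes_weaken, rule executes_While_step,
      simp add: assms, rule executes_Case_Nil, rule assms, rule executes_Pop,
      rule executes_While_Nil, use assms in auto)

lemma executes_true_loop_False:
  assumes "\<sigma> r = False # l" "\<sigma> g = [True]" "g \<noteq> r"
  shows "executes A (true_loop g r c) \<sigma> (\<sigma>(r := l, g := [])) 6"
  unfolding true_loop_def
  by (rule executes_weaken, rule executes_While_step,
      simp add: assms, rule executes_Case_False, rule assms,
      rule executes_Seq[OF executes_Pop executes_Pop],
      rule executes_While_Nil, use assms in auto)

lemma executes_true_loop_True: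
  assumes "\<sigma> r = True # l" "\<sigma> g = [True]"
    and "executes A c (\<sigma>(r := l)) \<sigma>1 T1"
    and "executes A (true_loop g r c) \<sigma>1 \<sigma>2 T2"
  shows "executes A (true_loop g r c) \<sigma> \<sigma>2 (T1 + T2 + 4)"
  unfolding true_loop_def
  by (rule executes_weaken, rule executes_While_step,
      simp add: assms, rule executes_Case_True, rule assms, rule executes_Seq[OF executes_Pop],
      simp add: assms(1), rule assms(3), rule assms(4)[unfolded true_loop_def]) auto

section \<open>Moving, clearing and copying stacks\<close>

definition move :: "reg \<Rightarrow> reg \<Rightarrow> prog" where
  "move r s = For r (Push s)"

definition clear :: "reg \<Rightarrow> prog" where
  "clear r = For r (\<lambda>_. Skip)"

text \<open>Stack 5 is scratch space.\<close>

definition copy :: "reg \<Rightarrow> reg \<Rightarrow> prog" where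
  "copy r s = move r 5 ;; For 5 (\<lambda>b. Push r b ;; Push s b)"

lemma executes_move:
  assumes "r \<noteq> s"
  shows "executes A (move r s) \<sigma> (\<sigma>(r := [], s := rev (\<sigma> r) @ \<sigma> s)) (5 * length (\<sigma> r) + 1)"
proof (induction "\<sigma> r" arbitrary: \<sigma>)
  case Nil
  show ?case unfolding move_def
    by (rule executes_weaken, rule executes_For_Nil, use Nil in \<open>auto simp: fun_eq_iff\<close>)
next
  case (Cons b l)
  show ?case unfolding move_def
    by (rule executes_weaken, rule executes_For_Cons, rule Cons(2)[symmetric], rule executes_Push,
        rule Cons(1)[unfolded move_def])
      (use assms in \<open>auto simp: fun_eq_iff simp flip: Cons(2)\<close>)
qed

lemma executes_clear:
  "executes A (clear r) \<sigma> (\<sigma>(r := [])) (5 * length (\<sigma> r) + 1)"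
proof (induction "\<sigma> r" arbitrary: \<sigma>)
  case Nil
  show ?case unfolding clear_def
    by (rule executes_weaken, rule executes_For_Nil, use Nil in \<open>auto simp: fun_eq_iff\<close>)
next
  case (Cons b l)
  show ?case unfolding clear_def
    by (rule executes_weaken, rule executes_For_Cons, rule Cons(2)[symmetric], rule executes_Skip,
        rule Cons(1)[unfolded clear_def])
      (auto simp: fun_eq_iff simp flip: Cons(2))
qed

lemma executes_For_Push2:
  assumes "r \<noteq> s" "r \<noteq> t" "s \<noteq> t"
  shows "executes A (For r (\<lambda>b. Push s b ;; Push t b)) \<sigma>
    (\<sigma>(r := [], s := rev (\<sigma> r) @ \<sigma> s, t := rev (\<sigma> r) @ \<sigma> t)) (7 * length (\<sigma> r) + 1)"
proof (induction "\<sigma> r" arbitrary: \<sigma>)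
  case Nil
  show ?case
    by (rule executes_weaken, rule executes_For_Nil, use Nil in \<open>auto simp: fun_eq_iff\<close>)
next
  case (Cons b l)
  show ?case
    by (rule executes_weaken, rule executes_For_Cons, rule Cons(2)[symmetric],
        rule executes_Seq[OF executes_Push executes_Push], rule Cons(1))
      (use assms in \<open>auto simp: fun_eq_iff simp flip: Cons(2)\<close>)
qed

text \<open>A move reverses its stack. Passing through stack 5 reverses twice, so both copies have
  the original order.\<close>

lemma executes_copy:
  assumes "r \<noteq> s" "r \<noteq> 5" "s \<noteq> 5" "\<sigma> 5 = []"
  shows "executes A (copy r s) \<sigma> (\<sigma>(s := \<sigma> r @ \<sigma> s)) (12 * length (\<sigma> r) + 3)"
  unfolding copy_def
  by (rule executes_weaken, rule executes_Seq[OF executes_move executes_For_Push2])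
    (use assms in \<open>auto simp: fun_eq_iff\<close>)

lemma executes_push_top:
  "executes A (branch r (Push s)) \<sigma> (\<sigma>(r := tl (\<sigma> r), s := take 1 (\<sigma> r) @ (\<sigma>(r := tl (\<sigma> r))) s)) 4"
proof (cases "\<sigma> r")
  case Nil
  then show ?thesis
    by (intro executes_weaken[OF executes_branch_Nil]) (auto simp: fun_eq_iff)
next
  case (Cons b l)
  then show ?thesis
    by (intro executes_weaken[OF executes_branch_Cons[where b = b and l = l, OF _ executes_Push]])
      (auto simp: fun_eq_iff)
qed

section \<open>Circuit evaluation\<close>

text \<open>This reader and those below fix the meaning of the evaluator on arbitrary strings, since
  time bounds and the NP language speak about all of them. A truncated numeral stops at the end of
  the string.\<close>

fun read_nat :: "bool list \<Rightarrow> nat \<times> bool list" where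
  "read_nat [] = (0, [])"
| "read_nat (False # c) = (0, c)"
| "read_nat (True # c) = (Suc (fst (read_nat c)), snd (read_nat c))"

text \<open>The list is a stack with its newest element on top, so positions count from the
  bottom.\<close>

definition entry :: "bool list \<Rightarrow> nat \<Rightarrow> bool" where
  "entry vs i \<longleftrightarrow> i < length vs \<and> rev vs ! i"

fun read_gate :: "bool list \<Rightarrow> bool list \<Rightarrow> bool list \<Rightarrow> bool list \<times> bool list" where
  "read_gate y (False # False # b # c) vs = (c, b # vs)"
| "read_gate y (False # True # c) vs = (snd (read_nat c), entry y (fst (read_nat c)) # vs)"
| "read_gate y (True # False # c) vs = (snd (read_nat c), (\<not> entry vs (fst (read_nat c))) # vs)"
| "read_gate y (True # True # b # c) vs =
     (let (i, c1) = read_nat c; (j, c2) = read_nat c1; p = entry vs i; q = entry vs j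
      in (c2, (if b then p \<or> q else p \<and> q) # vs))"
| "read_gate y [] vs = ([], vs)"
| "read_gate y [False] vs = ([], vs)"
| "read_gate y [False, False] vs = ([], vs)"
| "read_gate y [True] vs = ([], vs)"
| "read_gate y [True, True] vs = ([], vs)"

lemma length_read_nat: "length (snd (read_nat c)) \<le> length c"
  by (induction c rule: read_nat.induct) auto

lemma length_read_gate:
  "length (fst (read_gate y c vs)) \<le> length c"
  "length (snd (read_gate y c vs)) \<le> Suc (length vs)"
  by (induction y c vs rule: read_gate.induct)
    (auto simp: case_prod_beta Let_def
      intro!: le_SucI intro: length_read_nat order_trans[OF length_read_nat length_read_nat])

function read_circuit :: "bool list \<Rightarrow> bool list \<Rightarrow> bool list \<Rightarrow> bool list \<times> bool list" where
  "read_circuit y (True # c) vs = read_circuit y (fst (read_gate y c vs)) (snd (read_gate y c vs))"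
| "read_circuit y (False # c) vs = (c, vs)"
| "read_circuit y [] vs = ([], vs)"
  by pat_completeness auto
termination
  by (relation "Wellfounded.measure (\<lambda>(y, c, vs). length c)") (auto simp: case_prod_beta length_read_gate le_imp_less_Suc)

text \<open>Each gate uses up at least its leading marker and adds at most one value.\<close>

lemma length_read_circuit:
  "length (fst (read_circuit y c vs)) \<le> length c"
  "length (snd (read_circuit y c vs)) \<le> length c + length vs"
proof (induction y c vs rule: read_circuit.induct)
  case (1 y c vs)
  {
    case 1
    then show ?case using "1.IH"(1) length_read_gate(1)[of y c vs] by simp
  next
    case 2
    then show ?case using "1.IH"(2) length_read_gate[of y c vs] by simp
  }
qed auto

lemma read_nat_encode_nat: "read_nat (encode_nat k @ rest) = (k, rest)"
  by (induction k) (auto simp: encode_nat_def)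

lemma read_gate_encode_gate:
  assumes "wf_gate (length x) (length vs) g"
  shows "read_gate (rev x) (encode_gate g @ rest) (rev vs) = (rest, gate_value x vs g # rev vs)"
  using assms by (cases g) (auto simp: read_nat_encode_nat entry_def)

definition gate_values :: "circuit \<Rightarrow> bool list \<Rightarrow> bool list" where
  "gate_values C x = foldl (\<lambda>vs g. vs @ [gate_value x vs g]) [] C"

lemma read_circuit_encode_circuit:
  assumes "wf_circuit n C" "length x = n"
  shows "read_circuit (rev x) (encode_circuit C @ rest) [] = (rest, rev (gate_values C x))"
proof -
  have "read_circuit (rev x) (encode_circuit D @ rest) (rev vs)
      = (rest, rev (foldl (\<lambda>vs g. vs @ [gate_value x vs g]) vs D))"
    if "\<forall>k<length D. wf_gate n (length vs + k) (D ! k)" for D vs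
    using that
  proof (induction D arbitrary: vs)
    case Nil
    then show ?case by (simp add: encode_circuit_def)
  next
    case (Cons g D)
    have g: "wf_gate (length x) (length vs) g"
      using Cons.prems[rule_format, of 0] assms by simp
    have "\<forall>k<length D. wf_gate n (length (vs @ [gate_value x vs g]) + k) (D ! k)"
      using Cons.prems by auto
    from Cons.IH[OF this] read_gate_encode_gate[OF g, of "encode_circuit D @ rest"]
    show ?case by (simp add: encode_circuit_def)
  qed
  from this[of C "[]"] show ?thesis
    using assms by (simp add: wf_circuit_def gate_values_def)
qed

text \<open>Stack assignment: 2 circuit code, 3 reversed input, 4 reversed gate values, 6 operands,
  7 and 8 loop conditions.\<close>

definition lookup :: "reg \<Rightarrow> prog" where
  "lookup s = move s 5 ;; ForTrue 8 2 (branch 5 (Push s)) ;;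
     Case 5 (Push 6 False) (Push 6 True) (Push 6 False) ;; move 5 s"

text \<open>Each \<open>True\<close> of the unary index shifts one entry from stack 5 back to
  \<open>s\<close>. Once stack 5 is empty the shift does nothing, just as \<open>take\<close> and
  \<open>drop\<close> behave for an index that is too large.\<close>

lemma executes_lookup_loop:
  assumes "s \<notin> {2, 5, 8}" "\<sigma> 8 = [True]"
  shows "executes A (true_loop 8 2 (branch 5 (Push s))) \<sigma>
    (\<sigma>(2 := snd (read_nat (\<sigma> 2)), 5 := drop (fst (read_nat (\<sigma> 2))) (\<sigma> 5),
       s := rev (take (fst (read_nat (\<sigma> 2))) (\<sigma> 5)) @ \<sigma> s, 8 := [])) (8 * length (\<sigma> 2) + 6)"
  using assms(2)
proof (induction "\<sigma> 2" arbitrary: \<sigma>)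
  case Nil
  show ?case
    by (rule executes_weaken, rule executes_true_loop_Nil)
      (use Nil assms(1) in \<open>auto simp: fun_eq_iff simp flip: Nil(1)\<close>)
next
  case (Cons b l)
  note IH = Cons(1) and c = Cons(2) and g = Cons(3)
  show ?case
  proof (cases b)
    case False
    show ?thesis
      by (rule executes_weaken, rule executes_true_loop_False)
        (use g assms(1) False in \<open>auto simp: fun_eq_iff simp flip: c\<close>)
  next
    case True
    show ?thesis
    proof (cases "\<sigma> 5")
      case Nil
      show ?thesis
        by (rule executes_weaken, rule executes_true_loop_True[where l = l], use True c in simp,
            rule g, rule executes_branch_Nil, simp add: Nil, rule IH)
          (use g assms(1) True Nil in \<open>auto simp: fun_eq_iff simp flip: c\<close>)
    next
      case (Cons d m)
      show ?thesis
        by (rule executes_weaken, rule executes_true_loop_True[where l = l], use True c in simp,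
            rule g, rule executes_branch_Cons[where b = d and l = m], simp add: Cons,
            rule executes_Push, rule IH)
          (use g assms(1) True Cons in \<open>auto simp: fun_eq_iff simp flip: c\<close>)
    qed
  qed
qed

lemma executes_peek:
  "executes A (Case r (Push s False) (Push s True) (Push s False)) \<sigma>
     (\<sigma>(s := (\<sigma> r \<noteq> [] \<and> hd (\<sigma> r)) # \<sigma> s)) 2"
proof (cases "\<sigma> r")
  case Nil
  show ?thesis
    by (rule executes_weaken, rule executes_Case_Nil, rule Nil, rule executes_Push)
      (auto simp: Nil)
next
  case (Cons b l)
  show ?thesis
    by (cases b; rule executes_weaken, (rule executes_Case_True executes_Case_False, use Cons in simp, rule executes_Push))
      (auto simp: Cons)
qed

text \<open>Moving \<open>s\<close> to stack 5 brings the oldest entry to the top, so popping as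
  many entries as the index says exposes the one wanted; the last move restores \<open>s\<close>. An
  exhausted stack 5 is read as \<open>False\<close>, in agreement with \<open>entry\<close>.\<close>

lemma executes_lookup:
  assumes "s \<notin> {2, 5, 6, 8}" "\<sigma> 5 = []" "\<sigma> 8 = []"
  shows "executes A (lookup s) \<sigma>
    (\<sigma>(2 := snd (read_nat (\<sigma> 2)), 6 := entry (\<sigma> s) (fst (read_nat (\<sigma> 2))) # \<sigma> 6))
    (10 * length (\<sigma> s) + 8 * length (\<sigma> 2) + 20)"
  unfolding lookup_def ForTrue_def
  by (rule executes_weaken, rule executes_Seq[OF executes_move],
      use assms in simp, rule executes_Seq[OF executes_Seq[OF executes_Push executes_lookup_loop]],
      use assms in simp, use assms in simp,
      rule executes_Seq[OF executes_peek executes_move], simp)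
    (use assms in \<open>auto simp: fun_eq_iff entry_def hd_drop_conv_nth simp flip: rev_append\<close>)

text \<open>The operand looked up last lies on top of stack 6, so \<open>q\<close> is popped before
  \<open>p\<close>. On code truncated within the tag bits, some \<open>branch\<close> meets an empty
  stack and does nothing, as the last equations of \<open>read_gate\<close> prescribe.\<close>

definition eval_gate :: prog where
  "eval_gate = branch 2 (\<lambda>b1. branch 2 (\<lambda>b2.
     if b1 then
       (if b2 then branch 2 (\<lambda>b3. lookup 4 ;; lookup 4 ;;
            branch 6 (\<lambda>q. branch 6 (\<lambda>p. Push 4 (if b3 then p \<or> q else p \<and> q))))
        else lookup 4 ;; branch 6 (\<lambda>p. Push 4 (\<not> p)))
     else (if b2 then lookup 3 ;; branch 6 (Push 4) else branch 2 (Push 4))))"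

definition eval_circuit :: prog where
  "eval_circuit = ForTrue 7 2 eval_gate"

lemma executes_eval_gate:
  assumes [simp]: "\<sigma> 5 = []" "\<sigma> 6 = []" "\<sigma> 8 = []"
  shows "executes A eval_gate \<sigma>
    (\<sigma>(2 := fst (read_gate (\<sigma> 3) (\<sigma> 2) (\<sigma> 4)), 4 := snd (read_gate (\<sigma> 3) (\<sigma> 2) (\<sigma> 4))))
    (20 * (length (\<sigma> 2) + length (\<sigma> 3) + length (\<sigma> 4)) + 70)"
proof -
  have binary: "executes A (lookup 4 ;; lookup 4 ;; branch 6 (\<lambda>q. branch 6 (\<lambda>p. Push 4 (h p q))))
      (\<sigma>(2 := c)) (\<sigma>(2 := snd (read_nat (snd (read_nat c))),
        4 := h (entry (\<sigma> 4) (fst (read_nat c))) (entry (\<sigma> 4) (fst (read_nat (snd (read_nat c))))) # \<sigma> 4))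
      (20 * (length c + length (\<sigma> 4)) + 55)" for c h
    by (rule executes_weaken, rule executes_Seq[OF executes_lookup], simp, simp, simp,
        rule executes_Seq[OF executes_lookup], simp, simp, simp,
        rule executes_branch_Cons[where l = "[_]"], simp,
        rule executes_branch_Cons[where l = "[]"], simp, rule executes_Push)
      (use length_read_nat[of c] in \<open>auto simp: fun_eq_iff\<close>)
  have unary: "executes A (lookup s ;; branch 6 (\<lambda>p. Push 4 (h p)))
      (\<sigma>(2 := c)) (\<sigma>(2 := snd (read_nat c), 4 := h (entry (\<sigma> s) (fst (read_nat c))) # \<sigma> 4))
      (20 * (length c + length (\<sigma> s)) + 30)" if [simp]: "s \<noteq> 2" "s \<noteq> 5" "s \<noteq> 6" "s \<noteq> 8" for c h s
    by (rule executes_weaken, rule executes_Seq[OF executes_lookup], simp, simp, simp,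
        rule executes_branch_Cons[where l = "[]"], simp, rule executes_Push)
      (auto simp: fun_eq_iff)
  show ?thesis
  proof (cases "(\<sigma> 3, \<sigma> 2, \<sigma> 4)" rule: read_gate.cases)
    case (1 y b c vs)
    show ?thesis unfolding eval_gate_def
      by (rule executes_weaken,
          rule executes_branch_Cons[where b = False and l = "False # b # c"], use 1 in simp,
          rule executes_branch_Cons[where b = False and l = "b # c"], simp, simp,
          rule executes_branch_Cons[where b = b and l = "c"], simp, rule executes_Push)
        (use 1 in \<open>auto simp: fun_eq_iff\<close>)
  next
    case (2 y c vs)
    show ?thesis unfolding eval_gate_def
      by (rule executes_weaken,
          rule executes_branch_Cons[where b = False and l = "True # c"], use 2 in simp,
          rule executes_branch_Cons[where b = True and l = "c"], simp, simp,
          rule unary[where s = 3 and c = c and h = "\<lambda>p. p"], simp, simp, simp, simp)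
        (use 2 in \<open>auto simp: fun_eq_iff\<close>)
  next
    case (3 y c vs)
    show ?thesis unfolding eval_gate_def
      by (rule executes_weaken,
          rule executes_branch_Cons[where b = True and l = "False # c"], use 3 in simp,
          rule executes_branch_Cons[where b = False and l = "c"], simp, simp,
          rule unary[where s = 4 and c = c and h = "\<lambda>p. \<not> p"], simp, simp, simp, simp)
        (use 3 in \<open>auto simp: fun_eq_iff\<close>)
  next
    case (4 y b c vs)
    show ?thesis unfolding eval_gate_def
      by (rule executes_weaken,
          rule executes_branch_Cons[where b = True and l = "True # b # c"], use 4 in simp,
          rule executes_branch_Cons[where b = True and l = "b # c"], simp, simp,
          rule executes_branch_Cons[where b = b and l = "c"], simp, simp,
          rule binary[where c = c and h = "\<lambda>p q. if b then p \<or> q else p \<and> q"])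
        (use 4 in \<open>auto simp: fun_eq_iff split: prod.splits\<close>)
  next
    case (5 y vs)
    show ?thesis unfolding eval_gate_def
      by (rule executes_weaken, rule executes_branch_Nil) (use 5 in \<open>auto simp: fun_eq_iff\<close>)
  next
    case (6 y vs)
    show ?thesis unfolding eval_gate_def
      by (rule executes_weaken, rule executes_branch_Cons[where b = False and l = "[]"], use 6 in simp,
          rule executes_branch_Nil) (use 6 in \<open>auto simp: fun_eq_iff\<close>)
  next
    case (7 y vs)
    show ?thesis unfolding eval_gate_def
      by (rule executes_weaken, rule executes_branch_Cons[where b = False and l = "[False]"], use 7 in simp,
          rule executes_branch_Cons[where b = False and l = "[]"], simp, simp,
          rule executes_branch_Nil) (use 7 in \<open>auto simp: fun_eq_iff\<close>)
  next
    case (8 y vs)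
    show ?thesis unfolding eval_gate_def
      by (rule executes_weaken, rule executes_branch_Cons[where b = True and l = "[]"], use 8 in simp,
          rule executes_branch_Nil) (use 8 in \<open>auto simp: fun_eq_iff\<close>)
  next
    case (9 y vs)
    show ?thesis unfolding eval_gate_def
      by (rule executes_weaken, rule executes_branch_Cons[where b = True and l = "[True]"], use 9 in simp,
          rule executes_branch_Cons[where b = True and l = "[]"], simp, simp,
          rule executes_branch_Nil) (use 9 in \<open>auto simp: fun_eq_iff\<close>)
  qed
qed

text \<open>The total length of the three stacks never grows, because a gate consumes its marker and
  adds at most one value. So \<open>m\<close> bounds the cost of every gate, and there are at most
  as many gates as code bits.\<close>

lemma executes_eval_circuit_loop:
  assumes "\<sigma> 5 = []" "\<sigma> 6 = []" "\<sigma> 7 = [True]" "\<sigma> 8 = []"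
    and "length (\<sigma> 2) + length (\<sigma> 3) + length (\<sigma> 4) \<le> m"
  shows "executes A (true_loop 7 2 eval_gate) \<sigma>
    (\<sigma>(2 := fst (read_circuit (\<sigma> 3) (\<sigma> 2) (\<sigma> 4)), 4 := snd (read_circuit (\<sigma> 3) (\<sigma> 2) (\<sigma> 4)), 7 := []))
    (length (\<sigma> 2) * (20 * m + 80) + 6)"
  using assms
proof (induction "\<sigma> 3" "\<sigma> 2" "\<sigma> 4" arbitrary: \<sigma> rule: read_circuit.induct)
  case (1 c)
  let ?c = "fst (read_gate (\<sigma> 3) c (\<sigma> 4))" and ?v = "snd (read_gate (\<sigma> 3) c (\<sigma> 4))"
  have len: "length ?c \<le> length c" "length ?v \<le> Suc (length (\<sigma> 4))"
    by (rule length_read_gate)+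
  have le: "length ?c * (20 * m + 80) \<le> length c * (20 * m + 80)"
    using len(1) by (rule mult_right_mono) simp
  let ?\<sigma> = "\<sigma>(2 := ?c, 4 := ?v)"
  note eq = 1(2)[symmetric]
  have IH: "executes A (true_loop 7 2 eval_gate) ?\<sigma>
    (?\<sigma>(2 := fst (read_circuit (?\<sigma> 3) (?\<sigma> 2) (?\<sigma> 4)), 4 := snd (read_circuit (?\<sigma> 3) (?\<sigma> 2) (?\<sigma> 4)), 7 := []))
    (length (?\<sigma> 2) * (20 * m + 80) + 6)"
    by (rule 1(1)) (use 1(3-) len eq in auto)
  show ?case
    by (rule executes_weaken, rule executes_true_loop_True[where l = c], rule eq, rule 1,
        rule executes_weaken[OF executes_eval_gate _ order_refl, where ?\<sigma>2.0 = ?\<sigma>],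
        use 1(3-) in simp, use 1(3-) in simp, use 1(3-) in simp, simp add: fun_eq_iff, rule IH,
        simp add: fun_eq_iff eq, simp add: eq, use 1(7) le in \<open>simp only: eq list.size; linarith\<close>)
next
  case (2 c)
  show ?case
    by (rule executes_weaken, rule executes_true_loop_False)
      (use 2 in \<open>auto simp: fun_eq_iff simp flip: 2(1)\<close>)
next
  case 3
  show ?case
    by (rule executes_weaken, rule executes_true_loop_Nil)
      (use 3 in \<open>auto simp: fun_eq_iff simp flip: 3(1)\<close>)
qed

lemma executes_eval_circuit:
  assumes "\<sigma> 5 = []" "\<sigma> 6 = []" "\<sigma> 7 = []" "\<sigma> 8 = []"
    and "length (\<sigma> 2) + length (\<sigma> 3) + length (\<sigma> 4) \<le> m"
  shows "executes A eval_circuit \<sigma>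
    (\<sigma>(2 := fst (read_circuit (\<sigma> 3) (\<sigma> 2) (\<sigma> 4)), 4 := snd (read_circuit (\<sigma> 3) (\<sigma> 2) (\<sigma> 4))))
    (m * (20 * m + 80) + 10)"
proof -
  have le: "length (\<sigma> 2) * (20 * m + 80) \<le> m * (20 * m + 80)"
    using assms(5) by (intro mult_right_mono) auto
  show ?thesis
    unfolding eval_circuit_def ForTrue_def
    by (rule executes_weaken,
        rule executes_Seq[OF executes_Push executes_eval_circuit_loop[where m = m]],
        use assms in \<open>simp_all add: fun_eq_iff\<close>, use le in linarith)
qed

section \<open>The oracle\<close>

text \<open>Self-delimiting, so that several strings can be joined in one query, and in the format
  that a \<open>ForTrue\<close> loop consumes.\<close>

definition encode_bits :: "bool list \<Rightarrow> bool list" where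
  "encode_bits l = concat (map (\<lambda>b. [True, b]) l) @ [False]"

fun read_bits :: "bool list \<Rightarrow> bool list \<Rightarrow> bool list \<times> bool list" where
  "read_bits (True # b # c) l = read_bits c (b # l)"
| "read_bits [True] l = ([], l)"
| "read_bits (False # c) l = (c, l)"
| "read_bits [] l = ([], l)"

text \<open>Bits selected by the mask \<open>m\<close> are taken from the witness \<open>w\<close>. When \<open>w\<close> runs out the original bits
  are kept, so that every witness describes an admissible point.\<close>

fun overlay :: "bool list \<Rightarrow> bool list \<Rightarrow> bool list \<Rightarrow> bool list \<Rightarrow> bool list" where
  "overlay (True # b # c) [] w y = overlay c [] w y"
| "overlay (True # b # c) (False # m) w y = overlay c m w (b # y)"
| "overlay (True # b # c) (True # m) [] y = overlay c m [] (b # y)"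
| "overlay (True # b # c) (True # m) (d # w) y = overlay c m w (d # y)"
| "overlay [True] m w y = y"
| "overlay (False # c) m w y = y"
| "overlay [] m w y = y"

lemma length_read_bits:
  "length (fst (read_bits c l)) \<le> length c"
  "length (snd (read_bits c l)) \<le> length c + length l"
  by (induction c l rule: read_bits.induct) auto

lemma fst_read_bits: "fst (read_bits c l) = fst (read_bits c k)"
  by (induction c l arbitrary: k rule: read_bits.induct) auto

lemma length_overlay: "length (overlay c m w y) \<le> length c + length y"
  by (induction c m w y rule: overlay.induct) auto

lemma read_bits_encode_bits: "read_bits (encode_bits l @ c) k = (c, rev l @ k)"
  by (induction l arbitrary: k) (auto simp: encode_bits_def)

text \<open>Soundness of the witness format, for witnesses of any length: \<open>d\<close> is the
  bit chosen at the current coordinate and \<open>v\<close> the rest of the witness.\<close>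

lemma overlay_encode_bits:
  assumes "length m = length x"
  shows "\<exists>y. length y = length x \<and> (\<forall>i<length x. \<not> m ! i \<longrightarrow> y ! i = x ! i) \<and>
    overlay (encode_bits x @ c) m w l = rev y @ l"
  using assms
proof (induction m x arbitrary: w l rule: list_induct2)
  case Nil
  then show ?case by (simp add: encode_bits_def)
next
  case (Cons a m b x)
  define d where "d = (if a \<and> w \<noteq> [] then hd w else b)"
  define v where "v = (if a then tl w else w)"
  obtain y where y: "length y = length x" "\<forall>i<length x. \<not> m ! i \<longrightarrow> y ! i = x ! i"
    "overlay (encode_bits x @ c) m v (d # l) = rev y @ d # l"
    using Cons.IH[of v "d # l"] by blast
  have "overlay (encode_bits (b # x) @ c) (a # m) w l = overlay (encode_bits x @ c) m v (d # l)"
    by (cases a; cases w) (auto simp: encode_bits_def d_def v_def)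
  then show ?case
    using y by (intro exI[of _ "d # y"]) (auto simp: All_less_Suc2 d_def)
qed

text \<open>Completeness of the witness format: the witness lists the bits of \<open>y\<close> at
  the selected coordinates only.\<close>

lemma overlay_surj:
  assumes "length m = length x" "length x = length y" "\<forall>i<length x. \<not> m ! i \<longrightarrow> y ! i = x ! i"
  shows "\<exists>w. length w \<le> length x \<and> overlay (encode_bits x @ c) m w l = rev y @ l"
  using assms
proof (induction m x y arbitrary: l rule: list_induct3)
  case Nil
  then show ?case by (simp add: encode_bits_def)
next
  case (Cons a m b x d y)
  then obtain w where w: "length w \<le> length x" "overlay (encode_bits x @ c) m w (d # l) = rev y @ d # l"
    using Cons.IH[of "d # l"] by (auto simp: All_less_Suc2)
  have "a \<or> d = b" using Cons.prems by (auto simp: All_less_Suc2)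
  then show ?case
    using w by (intro exI[of _ "if a then d # w else w"]) (auto simp: encode_bits_def)
qed

text \<open>What the verifier computes. Behind the mask, \<open>c\<close> begins with the reference
  value, followed by the encoded point and the circuit code. Empty lists lead to rejection, so
  \<open>hd\<close> matters only where it is meaningful.\<close>

definition accepts :: "bool list \<Rightarrow> bool list \<Rightarrow> bool" where
  "accepts q w = (let (c, m) = read_bits q []; y = overlay (tl c) m w [];
       vs = snd (read_circuit y (fst (read_bits (tl c) [])) [])
     in c \<noteq> [] \<and> vs \<noteq> [] \<and> hd vs \<noteq> hd c)"

definition block_oracle :: "bool list set" where
  "block_oracle = {q. \<exists>w. length w \<le> length q \<and> accepts q w}"

text \<open>The mask is reversed because the machine pushes it front first; \<open>read_bits\<close>
  reverses it again. The point is repeated ahead of the instance since the verifier needs it before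
  it evaluates the circuit. Everything behind the mask is common to all queries on an instance and
  is prepared once.\<close>

definition query :: "circuit \<Rightarrow> bool list \<Rightarrow> bool list \<Rightarrow> bool list" where
  "query C x m = encode_bits (rev m) @ circuit_fun C x # encode_bits x @ encode_instance C x"

lemma length_gate_values: "length (gate_values C x) = length C"
proof -
  have "length (foldl (\<lambda>vs g. vs @ [gate_value x vs g]) vs C) = length vs + length C" for vs
    by (induction C arbitrary: vs) auto
  then show ?thesis by (simp add: gate_values_def)
qed

lemma query_in_block_oracle:
  assumes C: "wf_circuit n C" and x: "length x = n" and m: "length m = n"
  shows "query C x m \<in> block_oracle \<longleftrightarrow> sensitive n (circuit_fun C) x (mask_set m)"
proof -
  let ?c = "encode_bits x @ encode_instance C x"
  have accepts: "accepts (query C x m) w \<longleftrightarrow> circuit_fun C y \<noteq> circuit_fun C x"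
    if "overlay ?c m w [] = rev y" "length y = n" for w y
  proof -
    have "gate_values C y \<noteq> []"
      using C length_gate_values[of C y] by (auto simp: wf_circuit_def)
    moreover have "circuit_fun C y = last (gate_values C y)"
      by (simp add: circuit_fun_def gate_values_def)
    ultimately show ?thesis
      using that read_circuit_encode_circuit[OF C that(2), of x]
      by (simp add: accepts_def query_def read_bits_encode_bits encode_instance_def hd_rev)
  qed
  show ?thesis
  proof
    assume "query C x m \<in> block_oracle"
    then obtain w where w: "accepts (query C x m) w" by (auto simp: block_oracle_def)
    obtain y where y: "length y = n" "\<forall>i<n. \<not> m ! i \<longrightarrow> y ! i = x ! i" "overlay ?c m w [] = rev y"
      using overlay_encode_bits[of m x "encode_instance C x" w "[]"] m x by auto
    then have "circuit_fun C y \<noteq> circuit_fun C x" using w accepts by blast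
    with y(1,2) show "sensitive n (circuit_fun C) x (mask_set m)"
      unfolding sensitive_def using m by (intro exI[of _ y]) simp
  next
    assume "sensitive n (circuit_fun C) x (mask_set m)"
    then obtain y where y: "length y = n" "\<forall>i<n. \<not> m ! i \<longrightarrow> y ! i = x ! i"
      "circuit_fun C y \<noteq> circuit_fun C x"
      unfolding sensitive_def using m by auto
    obtain w where w: "length w \<le> n" "overlay ?c m w [] = rev y"
      using overlay_surj[of m x y "encode_instance C x" "[]"] m x y by auto
    \<comment> \<open>The query contains \<open>x\<close>, so the witness respects the length bound
      in \<open>block_oracle\<close>.\<close>
    have "n \<le> length (query C x m)"
      using x by (simp add: query_def encode_instance_def)
    then show "query C x m \<in> block_oracle"
      using w accepts[OF w(2) y(1)] y(3) unfolding block_oracle_def by (auto intro!: exI[of _ w])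
  qed
qed

text \<open>Further stacks: 1 witness, 9 reference value, 10 mask.\<close>

definition read_mask :: prog where
  "read_mask = branch 0 (Push 10)"

definition read_overlay :: prog where
  "read_overlay = branch 0 (\<lambda>b. branch 10 (\<lambda>a.
     if a then Case 1 (Push 3 b) (Pop 1 ;; Push 3 True) (Pop 1 ;; Push 3 False) else Push 3 b))"

text \<open>The two moves keep the order of the circuit code and leave stack 0 empty, so the output
  is \<open>[True]\<close> or empty.\<close>

definition verifier :: prog where
  "verifier = ForTrue 7 0 read_mask ;; branch 0 (Push 9) ;; ForTrue 7 0 read_overlay ;;
     (move 0 5 ;; move 5 2 ;; eval_circuit) ;;
     branch 4 (\<lambda>v. branch 9 (\<lambda>b. if v = b then Skip else Push 0 True))"

lemma executes_read_mask_loop: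
  assumes "\<sigma> 7 = [True]"
  shows "executes A (true_loop 7 0 read_mask) \<sigma>
    (\<sigma>(0 := fst (read_bits (\<sigma> 0) (\<sigma> 10)), 10 := snd (read_bits (\<sigma> 0) (\<sigma> 10)), 7 := []))
    (8 * length (\<sigma> 0) + 10)"
  using assms
proof (induction "\<sigma> 0" "\<sigma> 10" arbitrary: \<sigma> rule: read_bits.induct)
  case (1 b c)
  show ?case
    by (rule executes_weaken, rule executes_true_loop_True[where l = "b # c"], simp add: 1, rule 1,
        unfold read_mask_def, rule executes_branch_Cons[where b = b and l = c], simp,
        rule executes_Push, rule 1(1)[unfolded read_mask_def])
      (use 1(3) in \<open>auto simp: fun_eq_iff simp flip: 1(2)\<close>)
next
  case 2
  show ?case
    by (rule executes_weaken, rule executes_true_loop_True[where l = "[]"], simp add: 2, rule 2,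
        unfold read_mask_def, rule executes_branch_Nil, simp,
        rule executes_true_loop_Nil)
      (use 2 in \<open>auto simp: fun_eq_iff simp flip: 2(1)\<close>)
next
  case (3 c)
  show ?case
    by (rule executes_weaken, rule executes_true_loop_False)
      (use 3 in \<open>auto simp: fun_eq_iff simp flip: 3(1)\<close>)
next
  case 4
  show ?case
    by (rule executes_weaken, rule executes_true_loop_Nil)
      (use 4 in \<open>auto simp: fun_eq_iff simp flip: 4(1)\<close>)
qed

text \<open>The leftovers of mask and witness are of no interest later, hence the existential
  quantifiers.\<close>

lemma executes_read_overlay_loop:
  assumes "\<sigma> 7 = [True]"
  shows "\<exists>m w. executes A (true_loop 7 0 read_overlay) \<sigma>
    (\<sigma>(0 := fst (read_bits (\<sigma> 0) []), 10 := m, 1 := w,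
       3 := overlay (\<sigma> 0) (\<sigma> 10) (\<sigma> 1) (\<sigma> 3), 7 := []))
    (14 * length (\<sigma> 0) + 10)"
  using assms
proof (induction "\<sigma> 0" "\<sigma> 10" "\<sigma> 1" "\<sigma> 3" arbitrary: \<sigma> rule: overlay.induct)
  case (1 b c)
  let ?\<sigma> = "\<sigma>(0 := c)"
  obtain m w where IH: "executes A (true_loop 7 0 read_overlay) ?\<sigma>
    (?\<sigma>(0 := fst (read_bits (?\<sigma> 0) []), 10 := m, 1 := w,
       3 := overlay (?\<sigma> 0) (?\<sigma> 10) (?\<sigma> 1) (?\<sigma> 3), 7 := []))
    (14 * length (?\<sigma> 0) + 10)"
    using 1(1)[of ?\<sigma>] 1(2-) by auto
  have "executes A read_overlay (\<sigma>(0 := b # c)) ?\<sigma> 10" unfolding read_overlay_def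
    by (rule executes_weaken, rule executes_branch_Cons[where b = b and l = c], simp,
        rule executes_branch_Nil) (use 1(3) in auto)
  from executes_true_loop_True[where l = "b # c", OF _ 1(4) this IH]
  show ?case
    by (intro exI, rule executes_weaken)
      (auto simp: fun_eq_iff 1(2)[symmetric] 1(3)[symmetric] fst_read_bits[of c "[b]" "[]"])
next
  case (2 b c m)
  let ?\<sigma> = "\<sigma>(0 := c, 10 := m, 3 := b # \<sigma> 3)"
  obtain m' w where IH: "executes A (true_loop 7 0 read_overlay) ?\<sigma>
    (?\<sigma>(0 := fst (read_bits (?\<sigma> 0) []), 10 := m', 1 := w,
       3 := overlay (?\<sigma> 0) (?\<sigma> 10) (?\<sigma> 1) (?\<sigma> 3), 7 := []))
    (14 * length (?\<sigma> 0) + 10)"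
    using 2(1)[of ?\<sigma>] 2(2-) by auto
  have "executes A read_overlay (\<sigma>(0 := b # c)) ?\<sigma> 10" unfolding read_overlay_def
    by (rule executes_weaken, rule executes_branch_Cons[where b = b and l = c], simp,
        rule executes_branch_Cons[where b = False and l = m], simp add: 2, simp, rule executes_Push)
      (auto simp: fun_eq_iff)
  from executes_true_loop_True[where l = "b # c", OF _ 2(4) this IH]
  show ?case
    by (intro exI, rule executes_weaken)
      (auto simp: fun_eq_iff 2(2)[symmetric] 2(3)[symmetric] fst_read_bits[of c "[b]" "[]"])
next
  case (3 b c m)
  let ?\<sigma> = "\<sigma>(0 := c, 10 := m, 3 := b # \<sigma> 3)"
  obtain m' w where IH: "executes A (true_loop 7 0 read_overlay) ?\<sigma>
    (?\<sigma>(0 := fst (read_bits (?\<sigma> 0) []), 10 := m', 1 := w,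
       3 := overlay (?\<sigma> 0) (?\<sigma> 10) (?\<sigma> 1) (?\<sigma> 3), 7 := []))
    (14 * length (?\<sigma> 0) + 10)"
    using 3(1)[of ?\<sigma>] 3(2-) by auto
  have "executes A read_overlay (\<sigma>(0 := b # c)) ?\<sigma> 10" unfolding read_overlay_def
    by (rule executes_weaken, rule executes_branch_Cons[where b = b and l = c], simp,
        rule executes_branch_Cons[where b = True and l = m], simp add: 3, simp,
        rule executes_Case_Nil, simp add: 3, rule executes_Push)
      (auto simp: fun_eq_iff)
  from executes_true_loop_True[where l = "b # c", OF _ 3(5) this IH]
  show ?case
    by (intro exI, rule executes_weaken)
      (auto simp: fun_eq_iff 3(2)[symmetric] 3(3)[symmetric] 3(4)[symmetric] fst_read_bits[of c "[b]" "[]"]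
        simp del: One_nat_def)
next
  case (4 b c m d w)
  let ?\<sigma> = "\<sigma>(0 := c, 10 := m, 1 := w, 3 := d # \<sigma> 3)"
  obtain m' w' where IH: "executes A (true_loop 7 0 read_overlay) ?\<sigma>
    (?\<sigma>(0 := fst (read_bits (?\<sigma> 0) []), 10 := m', 1 := w',
       3 := overlay (?\<sigma> 0) (?\<sigma> 10) (?\<sigma> 1) (?\<sigma> 3), 7 := []))
    (14 * length (?\<sigma> 0) + 10)"
    using 4(1)[of ?\<sigma>] 4(2-) by auto
  have inner: "executes A (Case 1 (Push 3 b) (Pop 1 ;; Push 3 True) (Pop 1 ;; Push 3 False))
      (\<sigma>(0 := c, 10 := m)) ?\<sigma> 4"
    by (cases d; rule executes_weaken,
        (rule executes_Case_True[where l = w] executes_Case_False[where l = w],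
         simp add: 4(4)[symmetric] del: One_nat_def,
         rule executes_Seq[OF executes_Pop executes_Push]))
      (auto simp: fun_eq_iff 4(4)[symmetric] simp del: One_nat_def)
  have "executes A read_overlay (\<sigma>(0 := b # c)) ?\<sigma> 10" unfolding read_overlay_def
    by (rule executes_weaken, rule executes_branch_Cons[where b = b and l = c], simp,
        rule executes_branch_Cons[where b = True and l = m], simp add: 4(3)[symmetric],
        simp only: if_True fun_upd_upd, rule inner) auto
  from executes_true_loop_True[where l = "b # c", OF _ 4(5) this IH]
  show ?case
    by (intro exI, rule executes_weaken)
      (auto simp: fun_eq_iff 4(2)[symmetric] 4(3)[symmetric] 4(4)[symmetric] fst_read_bits[of c "[b]" "[]"]
        simp del: One_nat_def)
next
  case 5
  show ?case
    by (intro exI, rule executes_weaken, rule executes_true_loop_True[where l = "[]"], simp add: 5, rule 5,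
        unfold read_overlay_def, rule executes_branch_Nil, simp,
        rule executes_true_loop_Nil)
      (use 5 in \<open>auto simp: fun_eq_iff simp flip: 5(1)\<close>)
next
  case (6 c)
  show ?case
    by (intro exI, rule executes_weaken, rule executes_true_loop_False)
      (use 6 in \<open>auto simp: fun_eq_iff simp flip: 6(1)\<close>)
next
  case 7
  show ?case
    by (intro exI, rule executes_weaken, rule executes_true_loop_Nil)
      (use 7 in \<open>auto simp: fun_eq_iff simp flip: 7(1)\<close>)
qed

lemma executes_verifier:
  assumes [simp]: "\<sigma> 0 = q" "\<sigma> 1 = w" "\<And>i. 2 \<le> i \<Longrightarrow> \<sigma> i = []"
  shows "\<exists>\<sigma>'. executes A verifier \<sigma> \<sigma>' (poly [:100, 200, 80:] (length q + length w)) \<and>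
    \<sigma>' 0 = (if accepts q w then [True] else [])"
proof -
  define c m where "c = fst (read_bits q [])" and "m = snd (read_bits q [])"
  define d y where "d = fst (read_bits (tl c) [])" and "y = overlay (tl c) m w []"
  define e vs where "e = fst (read_circuit y d [])" and "vs = snd (read_circuit y d [])"
  have len: "length c \<le> length q" "length d \<le> length q" "length y \<le> length q"
    using length_read_bits(1)[of q "[]"] length_read_bits(1)[of "tl c" "[]"]
      length_overlay[of "tl c" m w "[]"] by (auto simp: c_def d_def y_def)
  let ?\<sigma>1 = "\<sigma>(0 := c, 10 := m)"
  let ?\<sigma>2 = "\<sigma>(0 := tl c, 10 := m, 9 := take 1 c)"
  have mask: "executes A (ForTrue 7 0 read_mask) \<sigma> ?\<sigma>1 (8 * length q + 12)"
    unfolding ForTrue_def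
    by (rule executes_weaken, rule executes_Seq[OF executes_Push executes_read_mask_loop])
      (auto simp: fun_eq_iff c_def m_def)
  have ref: "executes A (branch 0 (Push 9)) ?\<sigma>1 ?\<sigma>2 4"
    by (rule executes_weaken, rule executes_push_top) (auto simp: fun_eq_iff)
  obtain m' w' where "executes A (true_loop 7 0 read_overlay) (?\<sigma>2(7 := [True]))
      (?\<sigma>2(0 := d, 10 := m', 1 := w', 3 := y, 7 := [])) (14 * length (tl c) + 10)"
    using executes_read_overlay_loop[of "?\<sigma>2(7 := [True])" A] assms(2)
    by (auto simp: d_def y_def fun_upd_twist simp del: One_nat_def)
  then have over: "executes A (ForTrue 7 0 read_overlay) ?\<sigma>2
      (?\<sigma>2(0 := d, 10 := m', 1 := w', 3 := y, 7 := [])) (14 * length q + 12)"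
    unfolding ForTrue_def using len
    by (intro executes_weaken[OF executes_Seq[OF executes_Push]]) auto
  let ?\<sigma>3 = "\<sigma>(9 := take 1 c, 10 := m', 1 := w', 3 := y, 0 := [], 2 := e, 4 := vs)"
  have eval: "executes A (move 0 5 ;; move 5 2 ;; eval_circuit)
      (?\<sigma>2(0 := d, 10 := m', 1 := w', 3 := y, 7 := [])) ?\<sigma>3
      (10 * length q + (2 * length q) * (20 * (2 * length q) + 80) + 14)"
    by (rule executes_weaken, rule executes_Seq[OF executes_move], simp,
        rule executes_Seq[OF executes_move], simp,
        rule executes_eval_circuit[where m = "2 * length q"])
      (use len in \<open>auto simp: fun_eq_iff e_def vs_def\<close>)
  have "\<exists>\<sigma>'. executes A (branch 4 (\<lambda>v. branch 9 (\<lambda>b. if v = b then Skip else Push 0 True)))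
      ?\<sigma>3 \<sigma>' 7 \<and> \<sigma>' 0 = (if c \<noteq> [] \<and> vs \<noteq> [] \<and> hd vs \<noteq> hd c then [True] else [])"
  proof (cases vs)
    case Nil
    then show ?thesis
      by (intro exI[of _ ?\<sigma>3] conjI executes_weaken[OF executes_branch_Nil]) auto
  next
    case vs: (Cons v l)
    show ?thesis
    proof (cases c)
      case Nil
      then show ?thesis using vs
        by (intro exI[of _ "?\<sigma>3(4 := l)"] conjI executes_weaken[OF
              executes_branch_Cons[where b = v and l = l, OF _ executes_branch_Nil]]) auto
    next
      case (Cons b c')
      have inner: "executes A (if v = b then Skip else Push 0 True) (?\<sigma>3(4 := l, 9 := []))
        (?\<sigma>3(4 := l, 9 := [], 0 := if v \<noteq> b then [True] else [])) 1"
        by (cases "v = b"; simp; rule executes_weaken, rule executes_Skip executes_Push)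
          (auto simp: fun_eq_iff)
      show ?thesis
        by (intro exI conjI, rule executes_weaken[OF _ refl],
            rule executes_branch_Cons[where b = v and l = l], simp add: vs,
            rule executes_branch_Cons[where b = b and l = "[]"], simp add: Cons, rule inner)
          (auto simp: vs Cons)
    qed
  qed
  moreover have "accepts q w \<longleftrightarrow> c \<noteq> [] \<and> vs \<noteq> [] \<and> hd vs \<noteq> hd c"
    by (simp add: accepts_def c_def m_def d_def y_def vs_def case_prod_beta Let_def)
  ultimately obtain \<sigma>' where final:
    "executes A (branch 4 (\<lambda>v. branch 9 (\<lambda>b. if v = b then Skip else Push 0 True))) ?\<sigma>3 \<sigma>' 7"
    "\<sigma>' 0 = (if accepts q w then [True] else [])"
    by auto
  \<comment> \<open>Evaluation with stacks of total length \<open>2 * N\<close> contributes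
    \<open>80 * N^2 + 160 * N\<close>; all other parts stay below \<open>40 * N + 100\<close>. This
    gives the coefficients of the polynomial.\<close>
  define a N where "a = (2 * length q) * (20 * (2 * length q) + 80)" and "N = length q + length w"
  have "a \<le> (2 * N) * (20 * (2 * N) + 80)"
    unfolding a_def N_def by (intro mult_mono) auto
  then have "a + 40 * N + 100 \<le> poly [:100, 200, 80:] N"
    by (simp add: algebra_simps)
  moreover have "length q \<le> N" by (simp add: N_def)
  ultimately have "executes A verifier \<sigma> \<sigma>' (poly [:100, 200, 80:] N)"
    unfolding verifier_def
    by (intro executes_weaken[OF executes_Seq[OF mask executes_Seq[OF ref executes_Seq[OF over
      executes_Seq[OF eval[folded a_def] final(1)]]]]] refl) linarith
  with final(2) show ?thesis unfolding N_def by blast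
qed

lemma block_oracle_in_NP: "block_oracle \<in> NP"
proof -
  let ?p = "[:100, 200, 80:] :: nat poly"
  \<comment> \<open>Stated for all bit strings of the right length, so that it yields both the time
    bound and the outcome on the all-\<open>False\<close> bits.\<close>
  have run: "\<exists>\<sigma>'. run {} verifier [q, w] bs = ([], \<sigma>') \<and> \<sigma>' 0 = (if accepts q w then [True] else [])"
    if "length bs = poly ?p (length q + length w)" for q w bs
  proof -
    obtain \<sigma>' where "executes {} verifier (\<lambda>i. if i < length [q, w] then [q, w] ! i else []) \<sigma>'
        (poly ?p (length q + length w))" "\<sigma>' 0 = (if accepts q w then [True] else [])"
      using executes_verifier[of "\<lambda>i. if i < length [q, w] then [q, w] ! i else []" q w "{}"] by auto
    then show ?thesis using executes_run[of "{}" verifier "[q, w]" \<sigma>' _ bs] that by auto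
  qed
  have "deterministic verifier" "oracle_free verifier"
    by (simp_all add: verifier_def ForTrue_def true_loop_def read_mask_def read_overlay_def branch_def
        For_def move_def eval_circuit_def eval_gate_def lookup_def)
  moreover have "runs_in_time {} verifier 2 (poly ?p)"
    unfolding runs_in_time_def
  proof (intro allI impI)
    fix xs :: "bool list list" and bs :: "bool list"
    assume "length xs = 2" and bs: "length bs = poly ?p (sum_list (map length xs))"
    then obtain q w where "xs = [q, w]" by (auto simp: length_Suc_conv numeral_2_eq_2)
    then show "halted (run {} verifier xs bs)"
      using run[of bs q w] bs by (auto simp: halted_def)
  qed
  moreover have "q \<in> block_oracle \<longleftrightarrow> (\<exists>w. length w \<le> poly [:0, 1:] (length q) \<and>
      result (run {} verifier [q, w] (replicate (poly ?p (length q + length w)) False)) = [True])" for q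
  proof -
    have "result (run {} verifier [q, w] (replicate (poly ?p (length q + length w)) False)) = [True]
        \<longleftrightarrow> accepts q w" for w
      using run[of "replicate (poly ?p (length q + length w)) False" q w]
      by (auto simp: result_def simp del: poly_pCons split: if_splits)
    then show ?thesis by (simp add: block_oracle_def)
  qed
  ultimately show ?thesis unfolding NP_def by blast
qed

section \<open>The machine\<close>

lemma fst_read_gate_encode_gate: "fst (read_gate y (encode_gate g @ rest) vs) = rest"
  by (cases g) (auto simp: read_nat_encode_nat)

text \<open>Where the circuit code ends depends neither on the point nor on the gate values. An
  evaluation without any input therefore serves to uncover what follows the code.\<close>

lemma fst_read_circuit_encode_circuit: "fst (read_circuit y (encode_circuit C @ rest) vs) = rest"
  by (induction C arbitrary: vs) (auto simp: encode_circuit_def fst_read_gate_encode_gate)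

text \<open>Further stacks: 11 current mask, 12 round counter, 13 and 14 final and remaining part of the
  block under construction, 15 oracle query, 16 answer.\<close>

definition emit :: "reg \<Rightarrow> reg \<Rightarrow> reg \<Rightarrow> prog" where
  "emit r s t = For r (\<lambda>b. Push s b ;; Push t b ;; Push t True)"

text \<open>The query is assembled from its end. Both parts of the mask pass through stack 5, so
  that stacks 13 and 14 are intact afterwards.\<close>

definition ask :: prog where
  "ask = copy 0 15 ;; Push 15 False ;; move 13 5 ;; emit 5 13 15 ;; emit 14 5 15 ;; move 5 14 ;;
     Query 15 16 ;; clear 15"

text \<open>A selected coordinate is dropped tentatively by pushing \<open>False\<close>; a negative
  answer reinstates it.\<close>

definition shrink_block :: prog where
  "shrink_block = For 14 (\<lambda>b. if b then Push 13 False ;; ask ;;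
       branch 16 (\<lambda>a. if a then Skip else Pop 13 ;; Push 13 True) else Push 13 False)"

definition subtract_block :: prog where
  "subtract_block = For 14 (\<lambda>b. if b then Pop 11 ;; Push 13 False else branch 11 (Push 13))"

definition block_round :: prog where
  "block_round = copy 11 14 ;; ask ;; branch 16 (\<lambda>a. if a then
     shrink_block ;; move 13 14 ;; subtract_block ;; move 13 11 else clear 14)"

text \<open>The first evaluation has an empty input stack and only strips the circuit code,
  uncovering the point. The second is the real one and leaves the point on stack 2 once more, to be
  encoded in front of the instance. Stack 0 then holds the part of the query behind the
  mask.\<close>

definition prepare :: prog where
  "prepare = copy 0 2 ;; eval_circuit ;; clear 4 ;; move 2 3 ;; copy 0 2 ;; eval_circuit ;;
     For 3 (\<lambda>_. Push 11 True ;; Push 12 True) ;; Push 0 False ;; move 2 5 ;;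
     For 5 (\<lambda>b. Push 0 b ;; Push 0 True) ;; branch 4 (Push 0) ;; clear 4"

definition machine :: prog where
  "machine = prepare ;; For 12 (\<lambda>_. block_round) ;; clear 0 ;; move 11 13 ;; For 13 (\<lambda>b. Push 0 (\<not> b))"

abbreviation marked :: "bool list \<Rightarrow> bool list" where
  "marked l \<equiv> concat (map (\<lambda>b. [True, b]) l)"

lemma executes_emit:
  assumes "r \<noteq> s" "r \<noteq> t" "s \<noteq> t"
  shows "executes A (emit r s t) \<sigma>
    (\<sigma>(r := [], s := rev (\<sigma> r) @ \<sigma> s, t := marked (rev (\<sigma> r)) @ \<sigma> t)) (9 * length (\<sigma> r) + 1)"
proof (induction "\<sigma> r" arbitrary: \<sigma>)
  case Nil
  show ?case unfolding emit_def
    by (rule executes_weaken, rule executes_For_Nil, use Nil in \<open>auto simp: fun_eq_iff\<close>)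
next
  case (Cons b l)
  show ?case unfolding emit_def
    by (rule executes_weaken, rule executes_For_Cons, rule Cons(2)[symmetric],
        rule executes_Seq[OF executes_Push executes_Seq[OF executes_Push executes_Push]],
        rule Cons(1)[unfolded emit_def])
      (use assms in \<open>auto simp: fun_eq_iff simp flip: Cons(2)\<close>)
qed

lemma length_marked: "length (marked l) = 2 * length l"
  by (induction l) auto

lemma executes_ask:
  assumes "\<sigma> 5 = []" "\<sigma> 15 = []"
  shows "executes A ask \<sigma>
    (\<sigma>(16 := (encode_bits (rev (rev (\<sigma> 13) @ \<sigma> 14)) @ \<sigma> 0 \<in> A) # \<sigma> 16))
    (17 * length (\<sigma> 0) + 24 * (length (\<sigma> 13) + length (\<sigma> 14)) + 40)"
  unfolding ask_def
  by (rule executes_weaken, rule executes_Seq[OF executes_copy], simp, simp, simp, rule assms,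
      rule executes_Seq[OF executes_Push], rule executes_Seq[OF executes_move], simp,
      rule executes_Seq[OF executes_emit], simp, simp, simp,
      rule executes_Seq[OF executes_emit], simp, simp, simp,
      rule executes_Seq[OF executes_move], simp,
      rule executes_Seq[OF executes_Query executes_clear])
    (use assms in \<open>auto simp: fun_eq_iff encode_bits_def length_marked\<close>)

text \<open>Each bit causes at most one query, and a query costs at most
  \<open>17 * N + 24 * N\<close> plus a constant, which explains the 41.\<close>

lemma executes_shrink_block:
  assumes "\<sigma> 5 = []" "\<sigma> 15 = []" "\<sigma> 16 = []"
    and "length (\<sigma> 0) \<le> N" "length (\<sigma> 13) + length (\<sigma> 14) \<le> N"
  shows "executes A shrink_block \<sigma>
    (\<sigma>(13 := shrink (\<lambda>m. encode_bits (rev m) @ \<sigma> 0 \<in> A) (\<sigma> 13) (\<sigma> 14), 14 := []))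
    (length (\<sigma> 14) * (41 * N + 60) + 1)"
  using assms
proof (induction "\<sigma> 14" arbitrary: \<sigma>)
  case Nil
  show ?case unfolding shrink_block_def
    by (rule executes_weaken, rule executes_For_Nil, use Nil in \<open>auto simp: fun_eq_iff simp flip: Nil(1)\<close>)
next
  case (Cons b m)
  let ?Q = "\<lambda>m. encode_bits (rev m) @ \<sigma> 0 \<in> A"
  let ?b = "b \<and> \<not> ?Q (rev (False # \<sigma> 13) @ m)"
  let ?\<sigma> = "\<sigma>(14 := m, 13 := ?b # \<sigma> 13)"
  have IH: "executes A shrink_block ?\<sigma>
    (?\<sigma>(13 := shrink (\<lambda>m. encode_bits (rev m) @ ?\<sigma> 0 \<in> A) (?\<sigma> 13) (?\<sigma> 14), 14 := []))
    (length (?\<sigma> 14) * (41 * N + 60) + 1)"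
    by (rule Cons(1)) (use Cons(3-) in \<open>auto simp flip: Cons(2)\<close>)
  \<comment> \<open>Strict because one bit has been popped from stack 14; this leaves room for the
    tentative \<open>False\<close>.\<close>
  have len: "length (\<sigma> 13) + length m < N"
    using Cons(7) by (simp flip: Cons(2))
  have "executes A (if b then Push 13 False ;; ask ;;
       branch 16 (\<lambda>a. if a then Skip else Pop 13 ;; Push 13 True) else Push 13 False)
     (\<sigma>(14 := m)) ?\<sigma> (41 * N + 56)"
  proof (cases b)
    case False
    then show ?thesis
      by simp (rule executes_weaken, rule executes_Push, auto simp: fun_eq_iff)
  next
    case True
    let ?\<tau> = "\<sigma>(14 := m, 13 := False # \<sigma> 13)"
    have b: "executes A (if a then Skip else Pop 13 ;; Push 13 True) ?\<tau>
        (?\<tau>(13 := (\<not> a) # \<sigma> 13)) 3" for a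
      by (cases a; simp; rule executes_weaken,
          rule executes_Skip executes_Seq[OF executes_Pop executes_Push]) (auto simp: fun_eq_iff)
    have t: "?\<tau>(16 := []) = ?\<tau>" using Cons(5) by (auto simp: fun_eq_iff)
    have "executes A (branch 16 (\<lambda>a. if a then Skip else Pop 13 ;; Push 13 True))
        (?\<tau>(16 := [a])) (?\<tau>(13 := (\<not> a) # \<sigma> 13)) 6" for a
      by (rule executes_weaken, rule executes_branch_Cons[where b = a and l = "[]"], simp,
          simp only: fun_upd_upd t, rule b) auto
    note branch = this[of "?Q (rev (False # \<sigma> 13) @ m)"]
    have ask: "executes A ask ?\<tau> (?\<tau>(16 := [?Q (rev (False # \<sigma> 13) @ m)])) (41 * N + 40)"
      by (rule executes_weaken, rule executes_ask) (use Cons(3-6) len in \<open>auto simp: fun_eq_iff\<close>)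
    have "executes A (Push 13 False) (\<sigma>(14 := m)) ?\<tau> 1"
      by (rule executes_weaken, rule executes_Push) auto
    from executes_Seq[OF this executes_Seq[OF ask branch]] True
    show ?thesis
      by simp (rule executes_weaken, assumption, auto simp: fun_eq_iff)
  qed
  from executes_For_Cons[where b = b and l = m, OF Cons(2)[symmetric] this IH[unfolded shrink_block_def]]
  show ?case unfolding shrink_block_def
    by (rule executes_weaken) (auto simp: fun_eq_iff simp flip: Cons(2))
qed

lemma executes_subtract_block:
  assumes "length (\<sigma> 11) = length (\<sigma> 14)"
  shows "executes A subtract_block \<sigma>
    (\<sigma>(11 := [], 13 := rev (map2 (\<lambda>a b. a \<and> \<not> b) (\<sigma> 11) (\<sigma> 14)) @ \<sigma> 13, 14 := []))
    (8 * length (\<sigma> 14) + 1)"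
  using assms
proof (induction "\<sigma> 11" "\<sigma> 14" arbitrary: \<sigma> rule: list_induct2')
  case 1
  show ?case unfolding subtract_block_def
    by (rule executes_weaken, rule executes_For_Nil)
      (auto simp: fun_eq_iff simp flip: 1(1,2))
next
  case (4 a u b m)
  let ?\<sigma> = "\<sigma>(11 := u, 14 := m, 13 := (a \<and> \<not> b) # \<sigma> 13)"
  have IH: "executes A subtract_block ?\<sigma>
    (?\<sigma>(11 := [], 13 := rev (map2 (\<lambda>a b. a \<and> \<not> b) (?\<sigma> 11) (?\<sigma> 14)) @ ?\<sigma> 13, 14 := []))
    (8 * length (?\<sigma> 14) + 1)"
    by (rule 4(1)) (use 4(2-) in \<open>auto simp flip: 4(2,3)\<close>)
  have "executes A (if b then Pop 11 ;; Push 13 False else branch 11 (Push 13)) (\<sigma>(14 := m)) ?\<sigma> 4"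
  proof (cases b)
    case True
    then show ?thesis
      by simp (rule executes_weaken, rule executes_Seq[OF executes_Pop executes_Push],
          auto simp: fun_eq_iff simp flip: 4(2))
  next
    case False
    then show ?thesis
      by simp (rule executes_weaken, rule executes_branch_Cons[where b = a and l = u],
          simp add: 4(2)[symmetric], rule executes_Push, auto simp: fun_eq_iff)
  qed
  from executes_For_Cons[where b = b and l = m, OF 4(3)[symmetric] this IH[unfolded subtract_block_def]]
  show ?case unfolding subtract_block_def
    by (rule executes_weaken) (auto simp: fun_eq_iff simp flip: 4(2,3))
qed auto

lemma executes_block_round:
  assumes "\<sigma> 5 = []" "\<sigma> 13 = []" "\<sigma> 14 = []" "\<sigma> 15 = []" "\<sigma> 16 = []"
    and len: "length (\<sigma> 0) \<le> N" "length (\<sigma> 11) \<le> N"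
  shows "executes A block_round \<sigma>
    (\<sigma>(11 := remove_block (\<lambda>m. encode_bits (rev m) @ \<sigma> 0 \<in> A) (\<sigma> 11))) (41 * N ^ 2 + 140 * N + 80)"
proof -
  let ?Q = "\<lambda>m. encode_bits (rev m) @ \<sigma> 0 \<in> A"
  let ?\<tau> = "\<sigma>(14 := \<sigma> 11)"
  have copy: "executes A (copy 11 14) \<sigma> ?\<tau> (12 * N + 3)"
    by (rule executes_weaken, rule executes_copy) (use assms in \<open>auto simp: fun_eq_iff\<close>)
  have ask: "executes A ask ?\<tau> (?\<tau>(16 := [?Q (\<sigma> 11)])) (41 * N + 40)"
    by (rule executes_weaken, rule executes_ask) (use assms in \<open>auto simp: fun_eq_iff\<close>)
  have t: "?\<tau>(16 := []) = ?\<tau>" using assms by (auto simp: fun_eq_iff)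
  have shrink: "executes A shrink_block ?\<tau> (\<sigma>(13 := rev (shrunk ?Q (\<sigma> 11)))) (N * (41 * N + 60) + 1)"
  proof -
    have "length (\<sigma> 11) * (41 * N + 60) \<le> N * (41 * N + 60)"
      using len by (intro mult_right_mono) auto
    then show ?thesis
      by - (rule executes_weaken, rule executes_shrink_block[where N = N],
          use assms in \<open>auto simp: fun_eq_iff shrunk_def\<close>)
  qed
  have move1: "executes A (move 13 14) (\<sigma>(13 := rev (shrunk ?Q (\<sigma> 11)))) (\<sigma>(14 := shrunk ?Q (\<sigma> 11)))
      (5 * N + 1)"
    by (rule executes_weaken, rule executes_move) (use assms in \<open>auto simp: fun_eq_iff length_shrunk\<close>)
  have sub: "executes A subtract_block (\<sigma>(14 := shrunk ?Q (\<sigma> 11)))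
      (\<sigma>(11 := [], 13 := rev (map2 (\<lambda>a b. a \<and> \<not> b) (\<sigma> 11) (shrunk ?Q (\<sigma> 11))))) (8 * N + 1)"
    by (rule executes_weaken, rule executes_subtract_block)
      (use assms in \<open>auto simp: fun_eq_iff length_shrunk\<close>)
  have move2: "executes A (move 13 11)
      (\<sigma>(11 := [], 13 := rev (map2 (\<lambda>a b. a \<and> \<not> b) (\<sigma> 11) (shrunk ?Q (\<sigma> 11)))))
      (\<sigma>(11 := map2 (\<lambda>a b. a \<and> \<not> b) (\<sigma> 11) (shrunk ?Q (\<sigma> 11)))) (5 * N + 1)"
    by (rule executes_weaken, rule executes_move) (use assms in \<open>auto simp: fun_eq_iff length_shrunk\<close>)
  have clear: "executes A (clear 14) ?\<tau> \<sigma> (5 * N + 1)"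
    by (rule executes_weaken, rule executes_clear) (use assms in \<open>auto simp: fun_eq_iff\<close>)
  have body: "executes A (if ?Q (\<sigma> 11) then shrink_block ;; move 13 14 ;; subtract_block ;; move 13 11 else clear 14)
      ?\<tau> (\<sigma>(11 := remove_block ?Q (\<sigma> 11))) (N * (41 * N + 60) + 18 * N + 10)"
  proof (cases "?Q (\<sigma> 11)")
    case True
    then show ?thesis
      by (simp add: remove_block_def)
        (rule executes_weaken, rule executes_Seq[OF shrink executes_Seq[OF move1 executes_Seq[OF sub move2]]], auto)
  next
    case False
    then show ?thesis
      by (simp add: remove_block_def) (rule executes_weaken, rule clear, auto)
  qed
  have "executes A (branch 16 (\<lambda>a. if a then shrink_block ;; move 13 14 ;; subtract_block ;; move 13 11
      else clear 14)) (?\<tau>(16 := [?Q (\<sigma> 11)])) (\<sigma>(11 := remove_block ?Q (\<sigma> 11)))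
      (N * (41 * N + 60) + 18 * N + 13)"
    by (rule executes_weaken, rule executes_branch_Cons[where b = "?Q (\<sigma> 11)" and l = "[]"], simp,
        simp only: fun_upd_upd t, rule body) auto
  then show ?thesis unfolding block_round_def
    by - (rule executes_weaken, rule executes_Seq[OF copy executes_Seq[OF ask]], assumption,
        auto simp: power2_eq_square algebra_simps)
qed

lemma executes_rounds:
  assumes "\<sigma> 5 = []" "\<sigma> 13 = []" "\<sigma> 14 = []" "\<sigma> 15 = []" "\<sigma> 16 = []"
    and len: "length (\<sigma> 0) \<le> N" "length (\<sigma> 11) \<le> N"
  shows "executes A (For 12 (\<lambda>_. block_round)) \<sigma>
    (\<sigma>(11 := (remove_block (\<lambda>m. encode_bits (rev m) @ \<sigma> 0 \<in> A) ^^ length (\<sigma> 12)) (\<sigma> 11), 12 := []))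
    (length (\<sigma> 12) * (41 * N ^ 2 + 140 * N + 84) + 1)"
  using assms
proof (induction "\<sigma> 12" arbitrary: \<sigma>)
  case Nil
  show ?case
    by (rule executes_weaken, rule executes_For_Nil, use Nil in \<open>auto simp: fun_eq_iff simp flip: Nil(1)\<close>)
next
  case (Cons b l)
  let ?r = "remove_block (\<lambda>m. encode_bits (rev m) @ \<sigma> 0 \<in> A)"
  let ?\<sigma> = "\<sigma>(12 := l, 11 := ?r (\<sigma> 11))"
  have "executes A block_round (\<sigma>(12 := l)) ?\<sigma> (41 * N ^ 2 + 140 * N + 80)"
    by (rule executes_weaken, rule executes_block_round[where N = N])
      (use Cons(3-) in \<open>auto simp: fun_eq_iff\<close>)
  moreover have "executes A (For 12 (\<lambda>_. block_round)) ?\<sigma>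
    (?\<sigma>(11 := (remove_block (\<lambda>m. encode_bits (rev m) @ ?\<sigma> 0 \<in> A) ^^ length (?\<sigma> 12)) (?\<sigma> 11), 12 := []))
    (length (?\<sigma> 12) * (41 * N ^ 2 + 140 * N + 84) + 1)"
    by (rule Cons(1)) (use Cons(3-) in \<open>auto simp: length_remove_block\<close>)
  ultimately show ?case
    by - (rule executes_weaken, rule executes_For_Cons, rule Cons(2)[symmetric], assumption, assumption,
        auto simp: fun_eq_iff funpow_swap1 simp flip: Cons(2))
qed

lemma executes_fill:
  "executes A (For 3 (\<lambda>_. Push 11 True ;; Push 12 True)) \<sigma>
    (\<sigma>(3 := [], 11 := replicate (length (\<sigma> 3)) True @ \<sigma> 11, 12 := replicate (length (\<sigma> 3)) True @ \<sigma> 12))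
    (7 * length (\<sigma> 3) + 1)"
proof (induction "\<sigma> 3" arbitrary: \<sigma>)
  case Nil
  show ?case
    by (rule executes_weaken, rule executes_For_Nil) (auto simp: fun_eq_iff simp flip: Nil(1))
next
  case (Cons b l)
  show ?case
    by (rule executes_weaken, rule executes_For_Cons, rule Cons(2)[symmetric],
        rule executes_Seq[OF executes_Push executes_Push], rule Cons(1))
      (auto simp: fun_eq_iff replicate_app_Cons_same simp flip: Cons(2))
qed

lemma executes_push_marked:
  "executes A (For 5 (\<lambda>b. Push 0 b ;; Push 0 True)) \<sigma>
    (\<sigma>(5 := [], 0 := marked (rev (\<sigma> 5)) @ \<sigma> 0)) (7 * length (\<sigma> 5) + 1)"
proof (induction "\<sigma> 5" arbitrary: \<sigma>)
  case Nil
  show ?case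
    by (rule executes_weaken, rule executes_For_Nil) (auto simp: fun_eq_iff simp flip: Nil(1))
next
  case (Cons b l)
  show ?case
    by (rule executes_weaken, rule executes_For_Cons, rule Cons(2)[symmetric],
        rule executes_Seq[OF executes_Push executes_Push], rule Cons(1))
      (auto simp: fun_eq_iff simp flip: Cons(2))
qed

lemma executes_push_negated:
  "executes A (For 13 (\<lambda>b. Push 0 (\<not> b))) \<sigma>
    (\<sigma>(13 := [], 0 := map Not (rev (\<sigma> 13)) @ \<sigma> 0)) (5 * length (\<sigma> 13) + 1)"
proof (induction "\<sigma> 13" arbitrary: \<sigma>)
  case Nil
  show ?case
    by (rule executes_weaken, rule executes_For_Nil) (auto simp: fun_eq_iff simp flip: Nil(1))
next
  case (Cons b l)
  show ?case
    by (rule executes_weaken, rule executes_For_Cons, rule Cons(2)[symmetric],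
        rule executes_Push, rule Cons(1))
      (auto simp: fun_eq_iff simp flip: Cons(2))
qed

text \<open>Stack 0 holds an arbitrary string here, as the time bound requires. \<open>x\<close> and
  \<open>z\<close> are what the two evaluations leave unread; on an encoded instance both are the
  input point.\<close>

lemma executes_prepare:
  assumes \<sigma>: "\<And>i. 0 < i \<Longrightarrow> \<sigma> i = []"
  defines "x \<equiv> fst (read_circuit [] (\<sigma> 0) [])"
  defines "z \<equiv> fst (read_circuit (rev x) (\<sigma> 0) [])" and "vs \<equiv> snd (read_circuit (rev x) (\<sigma> 0) [])"
  shows "executes A prepare \<sigma>
    (\<sigma>(0 := take 1 vs @ encode_bits z @ \<sigma> 0, 11 := replicate (length x) True,
       12 := replicate (length x) True)) (4 * length (\<sigma> 0) * (40 * length (\<sigma> 0) + 80) + 60 * length (\<sigma> 0) + 80)"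
proof -
  define I N E where "I = \<sigma> 0" and "N = length I" and "E = 2 * N * (20 * (2 * N) + 80)"
  define us where "us = snd (read_circuit [] I [])"
  have [simp]: "\<sigma> 0 = I" "\<sigma> (Suc 0) = []" "\<And>k. \<sigma> (numeral k) = []" "length I = N"
    using \<sigma> by (auto simp: I_def N_def)
  have len: "length x \<le> N" "length z \<le> N" "length vs \<le> N" "length us \<le> N"
    using length_read_circuit[of "[]" I "[]"] length_read_circuit[of "rev x" I "[]"]
    by (auto simp: x_def z_def vs_def us_def)
  have copy1: "executes A (copy 0 2) \<sigma> (\<sigma>(2 := I)) (12 * N + 3)"
    by (rule executes_weaken, rule executes_copy) auto
  have eval1: "executes A eval_circuit (\<sigma>(2 := I)) (\<sigma>(2 := x, 4 := us)) (E + 10)"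
    by (rule executes_weaken, rule executes_eval_circuit[where m = "2 * N"])
      (auto simp: x_def us_def E_def)
  have clear1: "executes A (clear 4) (\<sigma>(2 := x, 4 := us)) (\<sigma>(2 := x)) (5 * N + 1)"
    by (rule executes_weaken, rule executes_clear) (use len in \<open>auto simp: fun_eq_iff\<close>)
  have move1: "executes A (move 2 3) (\<sigma>(2 := x)) (\<sigma>(3 := rev x)) (5 * N + 1)"
    by (rule executes_weaken, rule executes_move) (use len in \<open>auto simp: fun_eq_iff\<close>)
  have copy2: "executes A (copy 0 2) (\<sigma>(3 := rev x)) (\<sigma>(3 := rev x, 2 := I)) (12 * N + 3)"
    by (rule executes_weaken, rule executes_copy) auto
  have eval2: "executes A eval_circuit (\<sigma>(3 := rev x, 2 := I)) (\<sigma>(3 := rev x, 2 := z, 4 := vs)) (E + 10)"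
    by (rule executes_weaken, rule executes_eval_circuit[where m = "2 * N"])
      (use len in \<open>auto simp: z_def vs_def E_def\<close>)
  let ?\<tau> = "\<sigma>(11 := replicate (length x) True, 12 := replicate (length x) True)"
  have fill: "executes A (For 3 (\<lambda>_. Push 11 True ;; Push 12 True)) (\<sigma>(3 := rev x, 2 := z, 4 := vs))
      (?\<tau>(2 := z, 4 := vs)) (7 * N + 1)"
    by (rule executes_weaken, rule executes_fill) (use len in \<open>auto simp: fun_eq_iff\<close>)
  have push: "executes A (Push 0 False) (?\<tau>(2 := z, 4 := vs)) (?\<tau>(2 := z, 4 := vs, 0 := False # I)) 1"
    by (rule executes_weaken, rule executes_Push) auto
  have move2: "executes A (move 2 5) (?\<tau>(2 := z, 4 := vs, 0 := False # I))
      (?\<tau>(4 := vs, 0 := False # I, 5 := rev z)) (5 * N + 1)"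
    by (rule executes_weaken, rule executes_move) (use len in \<open>auto simp: fun_eq_iff\<close>)
  have marked: "executes A (For 5 (\<lambda>b. Push 0 b ;; Push 0 True)) (?\<tau>(4 := vs, 0 := False # I, 5 := rev z))
      (?\<tau>(4 := vs, 0 := encode_bits z @ I)) (7 * N + 1)"
    by (rule executes_weaken, rule executes_push_marked)
      (use len in \<open>auto simp: fun_eq_iff encode_bits_def\<close>)
  have top: "executes A (branch 4 (Push 0)) (?\<tau>(4 := vs, 0 := encode_bits z @ I))
      (?\<tau>(4 := tl vs, 0 := take 1 vs @ encode_bits z @ I)) 4"
    by (rule executes_weaken, rule executes_push_top) (auto simp: fun_eq_iff)
  have clear2: "executes A (clear 4) (?\<tau>(4 := tl vs, 0 := take 1 vs @ encode_bits z @ I))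
      (?\<tau>(0 := take 1 vs @ encode_bits z @ I)) (5 * N + 1)"
    by (rule executes_weaken, rule executes_clear) (use len in \<open>auto simp: fun_eq_iff\<close>)
  have "executes A prepare \<sigma> (?\<tau>(0 := take 1 vs @ encode_bits z @ I)) (2 * E + 60 * N + 80)"
    unfolding prepare_def
    by (rule executes_weaken, rule executes_Seq[OF copy1 executes_Seq[OF eval1 executes_Seq[OF clear1
      executes_Seq[OF move1 executes_Seq[OF copy2 executes_Seq[OF eval2 executes_Seq[OF fill
      executes_Seq[OF push executes_Seq[OF move2 executes_Seq[OF marked
      executes_Seq[OF top clear2]]]]]]]]]]]) auto
  then show ?thesis
    by (rule executes_weaken) (auto simp: fun_eq_iff E_def algebra_simps)
qed

section \<open>Total running time and correctness of the machine\<close>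

definition time_poly :: "nat poly" where
  "time_poly = smult 4 ([:0, 1:] * [:80, 40:]) + [:200, 200:] +
     [:0, 1:] * (smult 41 ([:2, 3:] ^ 2) + smult 140 [:2, 3:] + [:84:])"

lemma executes_machine:
  fixes A :: "bool list set"
  assumes \<sigma>: "\<And>i. 0 < i \<Longrightarrow> \<sigma> i = []"
  defines "x \<equiv> fst (read_circuit [] (\<sigma> 0) [])"
  defines "z \<equiv> fst (read_circuit (rev x) (\<sigma> 0) [])" and "vs \<equiv> snd (read_circuit (rev x) (\<sigma> 0) [])"
  defines "Q \<equiv> \<lambda>m. encode_bits (rev m) @ take 1 vs @ encode_bits z @ \<sigma> 0 \<in> A"
  shows "executes A machine \<sigma> (\<sigma>(0 := map Not (greedy_mask Q (length x)))) (poly time_poly (length (\<sigma> 0)))"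
proof -
  define N B where "N = length (\<sigma> 0)" and "B = take 1 vs @ encode_bits z @ \<sigma> 0"
  \<comment> \<open>Length of the prepared stack 0: one value bit, at most \<open>2 * N + 1\<close>
    bits for the encoded point and \<open>N\<close> for the input. In \<open>time_poly\<close>,
    \<open>[:2, 3:]\<close> is this bound, used in each of at most \<open>N\<close> rounds; the
    first summand pays for the two evaluations and \<open>[:200, 200:]\<close> for the linear
    rest.\<close>
  let ?M = "3 * N + 2"
  define u where "u = greedy_mask Q (length x)"
  define D where "D = 41 * ?M ^ 2 + 140 * ?M + 84"
  have [simp]: "\<sigma> (Suc 0) = []" "\<And>k. \<sigma> (numeral k) = []"
    using \<sigma> by auto
  have len: "length x \<le> N" "length z \<le> N" "length B \<le> ?M" "length u \<le> N"
    using length_read_circuit(1)[of "[]" "\<sigma> 0" "[]"] length_read_circuit(1)[of "rev x" "\<sigma> 0" "[]"]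
    by (auto simp: x_def z_def B_def N_def encode_bits_def length_marked u_def length_greedy_mask)
  let ?t = "replicate (length x) True"
  have prepare: "executes A prepare \<sigma> (\<sigma>(0 := B, 11 := ?t, 12 := ?t)) (4 * N * (40 * N + 80) + 60 * N + 80)"
    by (rule executes_weaken, rule executes_prepare, rule \<sigma>)
      (auto simp: x_def z_def vs_def B_def N_def)
  have rounds: "executes A (For 12 (\<lambda>_. block_round)) (\<sigma>(0 := B, 11 := ?t, 12 := ?t))
      (\<sigma>(0 := B, 11 := u)) (N * D + 1)"
  proof -
    have "length x * D \<le> N * D" using len by simp
    moreover have "executes A (For 12 (\<lambda>_. block_round)) (\<sigma>(0 := B, 11 := ?t, 12 := ?t))
      (\<sigma>(0 := B, 11 := u)) (length x * D + 1)"
      by (rule executes_weaken, rule executes_rounds[where N = ?M])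
        (use len in \<open>auto simp: fun_eq_iff u_def greedy_mask_def Q_def B_def D_def\<close>)
    ultimately show ?thesis by - (rule executes_weaken, assumption, auto)
  qed
  have clear: "executes A (clear 0) (\<sigma>(0 := B, 11 := u)) (\<sigma>(0 := [], 11 := u)) (15 * N + 11)"
    by (rule executes_weaken, rule executes_clear) (use len in \<open>auto simp: fun_eq_iff\<close>)
  have move: "executes A (move 11 13) (\<sigma>(0 := [], 11 := u)) (\<sigma>(0 := [], 13 := rev u)) (5 * N + 1)"
    by (rule executes_weaken, rule executes_move) (use len in \<open>auto simp: fun_eq_iff\<close>)
  have out: "executes A (For 13 (\<lambda>b. Push 0 (\<not> b))) (\<sigma>(0 := [], 13 := rev u)) (\<sigma>(0 := map Not u)) (5 * N + 1)"
    by (rule executes_weaken, rule executes_push_negated) (use len in \<open>auto simp: fun_eq_iff\<close>)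
  have "poly time_poly N = 4 * N * (40 * N + 80) + 200 * N + 200 + N * D"
    by (simp add: time_poly_def D_def algebra_simps)
  then show ?thesis
    unfolding machine_def
    by - (rule executes_weaken, rule executes_Seq[OF prepare executes_Seq[OF rounds executes_Seq[OF clear
      executes_Seq[OF move out]]]], auto simp: u_def N_def)
qed

lemma runs_in_time_machine: "runs_in_time A machine 1 (poly time_poly)"
  unfolding runs_in_time_def
proof (intro allI impI)
  fix xs :: "bool list list" and bs :: "bool list"
  assume xs: "length xs = 1" and bs: "length bs = poly time_poly (sum_list (map length xs))"
  then obtain I where I: "xs = [I]" by (auto simp: length_Suc_conv)
  show "halted (run A machine xs bs)"
    using executes_run[OF executes_machine, of xs bs A] I bs by (simp add: halted_def)
qed

text \<open>On an encoded instance the prepared stack 0 is exactly \<open>query\<close> without its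
  mask, so the decision procedure used by the greedy removal is the oracle on such queries.\<close>

lemma result_machine:
  assumes C: "wf_circuit n C" and x: "length x = n"
    and bs: "length bs = poly time_poly (length (encode_instance C x))"
  shows "result (run block_oracle machine [encode_instance C x] bs)
    = map Not (greedy_mask (\<lambda>m. query C x m \<in> block_oracle) n)"
proof -
  let ?I = "encode_instance C x"
  have I: "fst (read_circuit y ?I []) = x" for y
    by (simp add: encode_instance_def fst_read_circuit_encode_circuit)
  have "gate_values C x \<noteq> []"
    using C length_gate_values[of C x] by (auto simp: wf_circuit_def)
  then have "take 1 (rev (gate_values C x)) = [circuit_fun C x]"
    by (cases "gate_values C x" rule: rev_cases) (auto simp: circuit_fun_def gate_values_def)
  moreover have "snd (read_circuit (rev x) ?I []) = rev (gate_values C x)"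
    using read_circuit_encode_circuit[OF C x] by (simp add: encode_instance_def)
  ultimately show ?thesis
    using executes_run[OF executes_machine, of "[?I]" bs block_oracle] bs x
    by (simp add: I result_def query_def)
qed

theorem theorem1p2:
  "\<exists>(A :: bool list set) (M :: prog) (p :: nat poly) (K :: nat).
     A \<in> NP \<and> runs_in_time A M 1 (poly p) \<and>
     (\<forall>s :: nat poly. \<exists>g :: nat \<Rightarrow> real. filterlim g at_top sequentially \<and>
       (\<forall>n C x. n > 0 \<longrightarrow> wf_circuit n C \<longrightarrow> length C \<le> poly s n \<longrightarrow> length x = n \<longrightarrow>
          measure_pmf.prob
            (result_dist A M [encode_instance C x] (poly p (length (encode_instance C x))))
            {out. \<exists>S. out = encode_set n S \<and> certificate n (circuit_fun C) x S \<and>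
                      card S \<le> K * Cert n (circuit_fun C) ^ 5}
          \<ge> 1 - real n powr (- g n)))"
proof (intro exI conjI allI impI)
  show "block_oracle \<in> NP" by (rule block_oracle_in_NP)
  show "runs_in_time block_oracle machine 1 (poly time_poly)" by (rule runs_in_time_machine)
  \<comment> \<open>The success probability is 1, so the identity can serve as the exponent
    \<open>g\<close>.\<close>
  show "filterlim real at_top sequentially" by (rule filterlim_real_sequentially)
  fix n :: nat and C :: circuit and x :: "bool list"
  assume C: "wf_circuit n C" and x: "length x = n"
  let ?I = "encode_instance C x" and ?f = "circuit_fun C"
  let ?Q = "\<lambda>m. query C x m \<in> block_oracle"
  let ?t = "poly time_poly (length ?I)"
  define S where "S = {..<n} - mask_set (greedy_mask ?Q n)"
  let ?good = "{out. \<exists>S. out = encode_set n S \<and> certificate n ?f x S \<and> card S \<le> 1 * Cert n ?f ^ 5}"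
  note S = greedy_mask_certificate[OF x query_in_block_oracle[OF C x], folded S_def]
  \<comment> \<open>Monotonicity in the exponent needs a base of at least 1, so the value 0
    (constant functions) is split off.\<close>
  have "Cert n ?f ^ 2 \<le> Cert n ?f ^ 5"
    by (cases "Cert n ?f = 0") (auto intro: power_increasing)
  moreover have "map Not (greedy_mask ?Q n) = encode_set n S"
    by (rule nth_equalityI) (auto simp: encode_set_def S_def length_greedy_mask)
  ultimately have good: "map Not (greedy_mask ?Q n) \<in> ?good"
    using S by auto
  have bits: "finite {bs :: bool list. length bs = ?t}" "{bs :: bool list. length bs = ?t} \<noteq> {}"
    using finite_lists_length_eq[of "UNIV :: bool set" ?t] Ex_list_of_length[of ?t] by auto
  \<comment> \<open>The output is the same for every string of random bits, so its distribution is a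
    point mass.\<close>
  have "result_dist block_oracle machine [?I] ?t
      = map_pmf (\<lambda>_. map Not (greedy_mask ?Q n)) (pmf_of_set {bs :: bool list. length bs = ?t})"
    unfolding result_dist_def
    by (intro map_pmf_cong refl) (use bits result_machine[OF C x] in auto)
  then have "measure_pmf.prob (result_dist block_oracle machine [?I] ?t) ?good = 1"
    using good by (simp add: map_pmf_const measure_pmf_single indicator_def measure_return_pmf)
  then show "measure_pmf.prob (result_dist block_oracle machine [?I] ?t) ?good \<ge> 1 - real n powr (- real n)"
    by simp
qed

end
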